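(* Let $M=G/H$ be a naturally reductive homogeneous space with a homogeneous spin structure. Then the first order differential operator $$\mathcal D\psi:=\sum_{i,j,k}\langle[Z_i,Z_j]_{\mathfrak m},Z_k\rangle\,Z_i\cdot Z_j\cdot Z_k(\psi)$$ is a $G$-invariant differential operator on spinor fields.
   Context: Setting. $M=G/H$ is a Riemannian homogeneous space of dimension $n$, reductive: $\mathfrak g=\mathfrak h\oplus\mathfrak m$ with $\mathrm{Ad}(H)\mathfrak m\subset\mathfrak m$; $\mathfrak m$ is identified with the tangent space at the base point and $\langle\,,\rangle$ is the inner product on $\mathfrak m$ induced by the metric. The subscript $\mathfrak m$ denotes the component in $\mathfrak m$. The metric is naturally reductive: $\langle[X,Y]_{\mathfrak m},Z\rangle+\langle Y,[X,Z]_{\mathfrak m}\rangle=0$ for all $X,Y,Z\in\mathfrak m$; it is also assumed that $\mathfrak g=\mathfrak m+[\mathfrak m,\mathfrak m]$. $Z_1,\dots,Z_n$ is an orthonormal basis of $\mathfrak m$. The Clifford algebra $\mathcal C(\mathfrak m)$ has relations $Z_i\cdot Z_j+Z_j\cdot Z_i=-2\delta_{ij}$. A homogeneous spin structure is a lift $\widetilde{\mathrm{Ad}}:H\to\mathrm{Spin}(\mathfrak m)$ of the isotropy representation $\mathrm{Ad}:H\to\mathrm{SO}(\mathfrak m)$; $\kappa:\mathrm{Spin}(\mathfrak m)\to\mathrm{GL}(\Delta_{\mathfrak m})$ is the spin representation. Spinor fields are smooth maps $\psi:G\to\Delta_{\mathfrak m}$ with $\psi(gh)=\kappa(\widetilde{\mathrm{Ad}}(h^{-1}))\psi(g)$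 for $g\in G$, $h\in H$, i.e. sections of $S=G\times_{\widetilde{\mathrm{Ad}}}\Delta_{\mathfrak m}$. In $Z_i\cdot Z_j\cdot Z_k(\psi)$, $Z_k(\psi)$ is the derivative of $\psi$ along the left invariant vector field induced by $Z_k$, and $Z_i,Z_j$ act by Clifford multiplication. A $G$-invariant differential operator on spinor fields is a differential operator mapping spinor fields (i.e. smooth maps $\psi:G\to\Delta_{\mathfrak m}$ with $\psi(gh)=\kappa(\widetilde{\mathrm{Ad}}(h^{-1}))\psi(g)$ for all $g\in G$, $h\in H$) to spinor fields and commuting with the action of $G$ by left translations, $(g\psi)(x)=\psi(g^{-1}x)$. *)

theory Defs
  imports "HOL-Analysis.Analysis" "HOL-Library.Function_Algebras" "HOL-Algebra.Group"
begin

text \<open>Pointwise real vector space structure on functions. Vector fields below are operators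
  on functions, so this makes the library notions of subspace, span, etc. available for them.\<close>

instantiation "fun" :: (type, real_vector) real_vector
begin

definition scaleR_fun :: "real \<Rightarrow> ('a \<Rightarrow> 'b) \<Rightarrow> 'a \<Rightarrow> 'b" where
  "scaleR_fun r f = (\<lambda>x. r *\<^sub>R f x)"

instance
  by standard (simp_all add: scaleR_fun_def plus_fun_def fun_eq_iff scaleR_add_right scaleR_add_left)

end


section \<open>Smooth maps and Lie groups\<close>

fun times_differentiable_on ::
  "nat \<Rightarrow> 'a::real_normed_vector set \<Rightarrow> ('a \<Rightarrow> 'b::real_normed_vector) \<Rightarrow> bool" where
  "times_differentiable_on 0 S f \<longleftrightarrow> continuous_on S f"
| "times_differentiable_on (Suc k) S f \<longleftrightarrow>
     (\<forall>x\<in>S. f differentiable (at x)) \<and>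
     (\<forall>v. times_differentiable_on k S (\<lambda>x. frechet_derivative f (at x) v))"

text \<open>Only used on open subsets \<open>S\<close> of Euclidean spaces.\<close>

definition smooth_on ::
  "'a::real_normed_vector set \<Rightarrow> ('a \<Rightarrow> 'b::real_normed_vector) \<Rightarrow> bool" where
  "smooth_on S f \<longleftrightarrow> (\<forall>k. times_differentiable_on k S f)"

type_synonym ('g, 'e) atlas = "('g set \<times> ('g \<Rightarrow> 'e)) set"

definition smooth_atlas ::
  "('g::topological_space, 'e::euclidean_space) atlas \<Rightarrow> bool" where
  "smooth_atlas A \<longleftrightarrow>
     (\<Union>(U, \<phi>)\<in>A. U) = UNIV \<and>
     (\<forall>(U, \<phi>)\<in>A. open U \<and> open (\<phi> ` U) \<and> homeomorphism U (\<phi> ` U) \<phi> (inv_into U \<phi>)) \<and>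
     (\<forall>(U, \<phi>)\<in>A. \<forall>(V, \<theta>)\<in>A. smooth_on (\<phi> ` (U \<inter> V)) (\<theta> \<circ> inv_into U \<phi>))"

definition smooth_map ::
  "('g, 'e::euclidean_space) atlas \<Rightarrow> ('g \<Rightarrow> 'v::real_normed_vector) \<Rightarrow> bool" where
  "smooth_map A f \<longleftrightarrow> (\<forall>(U, \<phi>)\<in>A. smooth_on (\<phi> ` U) (f \<circ> inv_into U \<phi>))"

locale lie_group = group G
  for G :: "'g::{t2_space, second_countable_topology} monoid" +
  fixes A :: "('g, 'e::euclidean_space) atlas"
  assumes carrier_UNIV: "carrier G = UNIV"
    and atlas: "smooth_atlas A"
    and continuous_mult: "continuous_on UNIV (\<lambda>p. fst p \<otimes>\<^bsub>G\<^esub> snd p)"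
    and smooth_mult: "\<forall>(U, \<phi>)\<in>A. \<forall>(V, \<theta>)\<in>A. \<forall>(W, \<omega>)\<in>A.
          smooth_on {(\<phi> x, \<theta> y) | x y. x \<in> U \<and> y \<in> V \<and> x \<otimes>\<^bsub>G\<^esub> y \<in> W}
            (\<lambda>p. \<omega> (inv_into U \<phi> (fst p) \<otimes>\<^bsub>G\<^esub> inv_into V \<theta> (snd p)))"
    and continuous_inv: "continuous_on UNIV (\<lambda>x. m_inv G x)"
    and smooth_inv: "\<forall>(U, \<phi>)\<in>A. \<forall>(V, \<theta>)\<in>A.
          smooth_on {\<phi> x | x. x \<in> U \<and> m_inv G x \<in> V} (\<lambda>p. \<theta> (m_inv G (inv_into U \<phi> p)))"


section \<open>The Lie algebra\<close>

text \<open>A vector field is given by its action on real valued smooth functions; in a chart it is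
  the derivative in the direction of a smooth coefficient function \<open>a\<close>. The value on
  non-smooth functions is fixed to be \<open>0\<close>, so that equality of vector fields is equality of
  operators.\<close>

type_synonym 'g vfield = "('g \<Rightarrow> real) \<Rightarrow> 'g \<Rightarrow> real"

definition smooth_vector_field :: "('g, 'e::euclidean_space) atlas \<Rightarrow> 'g vfield \<Rightarrow> bool" where
  "smooth_vector_field A X \<longleftrightarrow>
     (\<forall>f. \<not> smooth_map A f \<longrightarrow> X f = 0) \<and>
     (\<forall>(U, \<phi>)\<in>A. \<exists>a. smooth_on (\<phi> ` U) a \<and>
        (\<forall>f. smooth_map A f \<longrightarrow>
          (\<forall>x\<in>U. X f x = frechet_derivative (f \<circ> inv_into U \<phi>) (at (\<phi> x)) (a (\<phi> x)))))"

definition lie_algebra :: "'g monoid \<Rightarrow> ('g, 'e::euclidean_space) atlas \<Rightarrow> 'g vfield set" where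
  "lie_algebra G A = {X. smooth_vector_field A X \<and>
     (\<forall>f g x. smooth_map A f \<longrightarrow> X (\<lambda>y. f (g \<otimes>\<^bsub>G\<^esub> y)) x = X f (g \<otimes>\<^bsub>G\<^esub> x))}"

definition lie_bracket :: "'g vfield \<Rightarrow> 'g vfield \<Rightarrow> 'g vfield" where
  "lie_bracket X Y = (\<lambda>f. X (Y f) - Y (X f))"

text \<open>The adjoint action is the push-forward under conjugation by \<open>h\<close>.\<close>

definition Ad :: "'g monoid \<Rightarrow> 'g \<Rightarrow> 'g vfield \<Rightarrow> 'g vfield" where
  "Ad G h X = (\<lambda>f x. X (\<lambda>y. f (h \<otimes>\<^bsub>G\<^esub> y \<otimes>\<^bsub>G\<^esub> m_inv G h)) (m_inv G h \<otimes>\<^bsub>G\<^esub> x \<otimes>\<^bsub>G\<^esub> h))"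

definition one_parameter_subgroup ::
  "'g::topological_space monoid \<Rightarrow> ('g, 'e::euclidean_space) atlas \<Rightarrow> 'g vfield \<Rightarrow> (real \<Rightarrow> 'g) \<Rightarrow> bool" where
  "one_parameter_subgroup G A X \<gamma> \<longleftrightarrow>
     continuous_on UNIV \<gamma> \<and>
     (\<forall>s t. \<gamma> (s + t) = \<gamma> s \<otimes>\<^bsub>G\<^esub> \<gamma> t) \<and>
     (\<forall>f t. smooth_map A f \<longrightarrow> ((\<lambda>s. f (\<gamma> s)) has_real_derivative X f (\<gamma> t)) (at t))"

text \<open>The Lie algebra of a closed subgroup \<open>H\<close>: all \<open>X\<close> with \<open>exp (t X) \<in> H\<close> for every \<open>t\<close>.\<close>

definition subgroup_lie_algebra ::
  "'g::topological_space monoid \<Rightarrow> ('g, 'e::euclidean_space) atlas \<Rightarrow> 'g set \<Rightarrow> 'g vfield set" where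
  "subgroup_lie_algebra G A H =
     {X \<in> lie_algebra G A. \<exists>\<gamma>. one_parameter_subgroup G A X \<gamma> \<and> range \<gamma> \<subseteq> H}"

text \<open>Derivative of a vector valued map along a vector field, taken componentwise.\<close>

definition vderiv :: "'g vfield \<Rightarrow> ('g \<Rightarrow> 'v::euclidean_space) \<Rightarrow> 'g \<Rightarrow> 'v" where
  "vderiv X \<psi> g = (\<Sum>b\<in>Basis. X (\<lambda>x. \<psi> x \<bullet> b) g *\<^sub>R b)"


section \<open>Naturally reductive homogeneous spaces\<close>

definition is_direct_sum :: "'a::ab_group_add set \<Rightarrow> 'a set \<Rightarrow> 'a set \<Rightarrow> bool" where
  "is_direct_sum V P Q \<longleftrightarrow> P \<subseteq> V \<and> Q \<subseteq> V \<and>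
     (\<forall>x\<in>V. \<exists>!p. fst p \<in> P \<and> snd p \<in> Q \<and> x = fst p + snd p)"

definition m_part :: "'a::ab_group_add set \<Rightarrow> 'a set \<Rightarrow> 'a \<Rightarrow> 'a" where
  "m_part \<hh> \<mm> X = (THE W. W \<in> \<mm> \<and> (\<exists>Y\<in>\<hh>. X = Y + W))"

definition inner_product_on :: "'a::real_vector set \<Rightarrow> ('a \<Rightarrow> 'a \<Rightarrow> real) \<Rightarrow> bool" where
  "inner_product_on V ip \<longleftrightarrow>
     (\<forall>x\<in>V. \<forall>y\<in>V. ip x y = ip y x) \<and>
     (\<forall>x\<in>V. \<forall>y\<in>V. \<forall>z\<in>V. ip (x + y) z = ip x z + ip y z) \<and>
     (\<forall>r. \<forall>x\<in>V. \<forall>y\<in>V. ip (r *\<^sub>R x) y = r * ip x y) \<and>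
     (\<forall>x\<in>V. x \<noteq> 0 \<longrightarrow> ip x x > 0)"

text \<open>A \<open>G\<close>-invariant Riemannian metric on \<open>G/H\<close> is given by an \<open>Ad(H)\<close>-invariant inner
  product \<open>ip\<close> on the reductive complement \<open>\<mm>\<close>.\<close>

locale reductive_riemannian_homogeneous_space = lie_group G A
  for G :: "'g::{t2_space, second_countable_topology} monoid"
    and A :: "('g, 'e::euclidean_space) atlas" +
  fixes H :: "'g set"
    and \<mm> :: "'g vfield set"
    and ip :: "'g vfield \<Rightarrow> 'g vfield \<Rightarrow> real"
  assumes subgroup_H: "subgroup H G"
    and closed_H: "closed H"
    and subspace_m: "subspace \<mm>"
    and direct_sum: "is_direct_sum (lie_algebra G A) (subgroup_lie_algebra G A H) \<mm>"
    and Ad_H_m: "\<forall>h\<in>H. Ad G h ` \<mm> \<subseteq> \<mm>"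
    and inner_product: "inner_product_on \<mm> ip"
    and ip_invariant: "\<forall>h\<in>H. \<forall>X\<in>\<mm>. \<forall>Y\<in>\<mm>. ip (Ad G h X) (Ad G h Y) = ip X Y"

locale naturally_reductive_space = reductive_riemannian_homogeneous_space G A H \<mm> ip
  for G :: "'g::{t2_space, second_countable_topology} monoid"
    and A :: "('g, 'e::euclidean_space) atlas"
    and H \<mm> ip +
  assumes naturally_reductive: "\<forall>X\<in>\<mm>. \<forall>Y\<in>\<mm>. \<forall>W\<in>\<mm>.
      ip (m_part (subgroup_lie_algebra G A H) \<mm> (lie_bracket X Y)) W +
      ip Y (m_part (subgroup_lie_algebra G A H) \<mm> (lie_bracket X W)) = 0"
    and g_eq_m_plus_mm: "lie_algebra G A =
      {X + Y | X Y. X \<in> \<mm> \<and> Y \<in> span {lie_bracket U W | U W. U \<in> \<mm> \<and> W \<in> \<mm>}}"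

definition orthonormal_basis_of ::
  "'a::real_vector set \<Rightarrow> ('a \<Rightarrow> 'a \<Rightarrow> real) \<Rightarrow> ('n::finite \<Rightarrow> 'a) \<Rightarrow> bool" where
  "orthonormal_basis_of V ip Z \<longleftrightarrow>
     range Z \<subseteq> V \<and> span (range Z) = V \<and> (\<forall>i j. ip (Z i) (Z j) = (if i = j then 1 else 0))"


section \<open>Clifford algebra, spin group and spin representation\<close>

text \<open>The Clifford algebra of Euclidean space is the associative unital real algebra generated
  by \<open>e i\<close> subject to the relations below and to no others, i.e. the ordered monomials in
  the generators form a basis. Its topology (as a finite dimensional real vector space) is
  that of an arbitrary algebra norm.\<close>

definition clifford_monomial :: "('n::{finite, linorder} \<Rightarrow> 'c::monoid_mult) \<Rightarrow> 'n set \<Rightarrow> 'c" where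
  "clifford_monomial e S = prod_list (map e (sorted_list_of_set S))"

locale clifford_algebra =
  fixes e :: "'n::{finite, linorder} \<Rightarrow> 'c::real_normed_algebra_1"
  assumes clifford_relations: "e i * e j + e j * e i = (if i = j then - 2 else 0)"
    and monomials_inj: "inj (clifford_monomial e)"
    and monomials_independent: "independent (range (clifford_monomial e))"
    and monomials_span: "span (range (clifford_monomial e)) = UNIV"

definition clifford_vec :: "('n::finite \<Rightarrow> 'c::real_vector) \<Rightarrow> real ^ 'n \<Rightarrow> 'c" where
  "clifford_vec e v = (\<Sum>i\<in>UNIV. (v $ i) *\<^sub>R e i)"

definition spin_group :: "('n::finite \<Rightarrow> 'c::real_algebra_1) \<Rightarrow> 'c set" where
  "spin_group e = {prod_list (map (clifford_vec e) vs) | vs.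
     even (length vs) \<and> (\<forall>v\<in>set vs. norm v = 1)}"

definition clifford_inverse :: "'c::real_algebra_1 \<Rightarrow> 'c" where
  "clifford_inverse s = (THE t. s * t = 1 \<and> t * s = 1)"

text \<open>The twofold covering of the special orthogonal group by the spin group sends \<open>s\<close> to
  the map \<open>v \<mapsto> s v s\<^sup>-\<^sup>1\<close>.\<close>

definition spin_covering :: "'c::real_algebra_1 \<Rightarrow> 'c \<Rightarrow> 'c" where
  "spin_covering s v = s * v * clifford_inverse s"

text \<open>The spinor module is an irreducible complex module of the Clifford algebra; \<open>\<rho>\<close> is
  Clifford multiplication, and its restriction to the spin group is the spin representation.\<close>

locale spinor_module =
  fixes \<rho> :: "'c::real_algebra_1 \<Rightarrow> complex ^ 'd ^ 'd"
  assumes rho_linear: "linear \<rho>"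
    and rho_one: "\<rho> 1 = mat 1"
    and rho_mult: "\<rho> (a * b) = \<rho> a ** \<rho> b"
    and irreducible: "\<lbrakk>vec.subspace W; \<forall>a. \<forall>w\<in>W. \<rho> a *v w \<in> W\<rbrakk> \<Longrightarrow> W = {0} \<or> W = UNIV"

text \<open>Via the orthonormal basis \<open>Z\<close>, the element \<open>Z i\<close> of \<open>\<mm>\<close> is the Clifford generator \<open>e i\<close>.\<close>

definition m_coords ::
  "('a \<Rightarrow> 'a \<Rightarrow> real) \<Rightarrow> ('n::finite \<Rightarrow> 'a) \<Rightarrow> 'a \<Rightarrow> real ^ 'n" where
  "m_coords ip Z X = (\<chi> i. ip X (Z i))"

locale homogeneous_spin_structure =
  reductive_riemannian_homogeneous_space G A H \<mm> ip + clifford_algebra e + spinor_module \<rho>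
  for G :: "'g::{t2_space, second_countable_topology} monoid"
    and A :: "('g, 'e::euclidean_space) atlas"
    and H \<mm> ip
    and e :: "'n::{finite, linorder} \<Rightarrow> 'c::real_normed_algebra_1"
    and \<rho> :: "'c \<Rightarrow> complex ^ 'd ^ 'd" +
  fixes Z :: "'n \<Rightarrow> 'g vfield"
    and lift_Ad :: "'g \<Rightarrow> 'c"
  assumes orthonormal_basis: "orthonormal_basis_of \<mm> ip Z"
    and Ad_SO: "\<forall>h\<in>H. rotation_matrix (\<chi> i j. ip (Ad G h (Z j)) (Z i))"
    and lift_Spin: "lift_Ad ` H \<subseteq> spin_group e"
    and lift_hom: "\<forall>h\<in>H. \<forall>k\<in>H. lift_Ad (h \<otimes>\<^bsub>G\<^esub> k) = lift_Ad h * lift_Ad k"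
    and lift_continuous: "continuous_on H lift_Ad"
    and lift_covers: "\<forall>h\<in>H. \<forall>X\<in>\<mm>.
      spin_covering (lift_Ad h) (clifford_vec e (m_coords ip Z X)) =
      clifford_vec e (m_coords ip Z (Ad G h X))"

definition spinor_fields ::
  "'g monoid \<Rightarrow> ('g, 'e::euclidean_space) atlas \<Rightarrow> 'g set \<Rightarrow> ('c \<Rightarrow> complex ^ 'd ^ 'd) \<Rightarrow> ('g \<Rightarrow> 'c)
     \<Rightarrow> ('g \<Rightarrow> complex ^ 'd) set" where
  "spinor_fields G A H \<rho> lift_Ad = {\<psi>. smooth_map A \<psi> \<and>
     (\<forall>g. \<forall>h\<in>H. \<psi> (g \<otimes>\<^bsub>G\<^esub> h) = \<rho> (lift_Ad (m_inv G h)) *v \<psi> g)}"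


section \<open>Differential operators\<close>

fun iterated_derivative ::
  "'e::real_normed_vector list \<Rightarrow> ('e \<Rightarrow> 'v::real_normed_vector) \<Rightarrow> 'e \<Rightarrow> 'v" where
  "iterated_derivative [] F = F"
| "iterated_derivative (v # vs) F =
     (\<lambda>x. frechet_derivative (iterated_derivative vs F) (at x) v)"

text \<open>Differential operators of order at most \<open>k\<close> on smooth vector valued maps: in each chart
  a combination of iterated partial derivatives of length at most \<open>k\<close>, with smooth
  matrix valued coefficients.\<close>

definition differential_operator ::
  "('g, 'e::euclidean_space) atlas \<Rightarrow> nat \<Rightarrow>
   (('g \<Rightarrow> complex ^ 'd) \<Rightarrow> 'g \<Rightarrow> complex ^ 'd) \<Rightarrow> bool" where
  "differential_operator A k P \<longleftrightarrow>
     (\<forall>(U, \<phi>)\<in>A. \<exists>a :: 'e list \<Rightarrow> 'e \<Rightarrow> complex ^ 'd ^ 'd.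
        (\<forall>vs. smooth_on (\<phi> ` U) (a vs)) \<and>
        (\<forall>\<psi>. smooth_map A \<psi> \<longrightarrow> (\<forall>x\<in>U. P \<psi> x =
           (\<Sum>vs\<in>{vs. set vs \<subseteq> Basis \<and> length vs \<le> k}.
              a vs (\<phi> x) *v iterated_derivative vs (\<psi> \<circ> inv_into U \<phi>) (\<phi> x)))))"

definition left_translate :: "'g monoid \<Rightarrow> 'g \<Rightarrow> ('g \<Rightarrow> 'v) \<Rightarrow> 'g \<Rightarrow> 'v" where
  "left_translate G g \<psi> = (\<lambda>x. \<psi> (m_inv G g \<otimes>\<^bsub>G\<^esub> x))"

definition invariant_differential_operator ::
  "'g monoid \<Rightarrow> ('g, 'e::euclidean_space) atlas \<Rightarrow> ('g \<Rightarrow> complex ^ 'd) set \<Rightarrow> nat \<Rightarrow>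
   (('g \<Rightarrow> complex ^ 'd) \<Rightarrow> 'g \<Rightarrow> complex ^ 'd) \<Rightarrow> bool" where
  "invariant_differential_operator G A S k P \<longleftrightarrow>
     differential_operator A k P \<and>
     (\<forall>\<psi>\<in>S. P \<psi> \<in> S) \<and>
     (\<forall>g. \<forall>\<psi>\<in>S. left_translate G g \<psi> \<in> S \<and> P (left_translate G g \<psi>) = left_translate G g (P \<psi>))"

definition D_operator ::
  "'g::topological_space monoid \<Rightarrow> ('g, 'e::euclidean_space) atlas \<Rightarrow> 'g set \<Rightarrow> 'g vfield set \<Rightarrow>
   ('g vfield \<Rightarrow> 'g vfield \<Rightarrow> real) \<Rightarrow> ('n::finite \<Rightarrow> 'g vfield) \<Rightarrow> ('n \<Rightarrow> 'c) \<Rightarrow>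
   ('c \<Rightarrow> complex ^ 'd ^ 'd) \<Rightarrow> ('g \<Rightarrow> complex ^ 'd) \<Rightarrow> 'g \<Rightarrow> complex ^ 'd" where
  "D_operator G A H \<mm> ip Z e \<rho> \<psi> = (\<lambda>g. \<Sum>i\<in>UNIV. \<Sum>j\<in>UNIV. \<Sum>k\<in>UNIV.
     ip (m_part (subgroup_lie_algebra G A H) \<mm> (lie_bracket (Z i) (Z j))) (Z k) *\<^sub>R
       (\<rho> (e i) *v (\<rho> (e j) *v vderiv (Z k) \<psi> g)))"

end

theory Submission
  imports Defs
begin

text \<open>For \<open>h \<in> H\<close>, left invariance turns the derivative of \<open>\<psi>\<close> along \<open>Z k\<close> at \<open>g h\<close> into the derivative of
  \<open>x \<mapsto> \<psi> (x h) = \<kappa> (h\<^sup>-\<^sup>1) (\<psi> x)\<close> along \<open>Ad h (Z k)\<close> at \<open>g\<close>. Pulling \<open>\<kappa> (h\<^sup>-\<^sup>1)\<close> out to the left through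
  the Clifford product replaces each \<open>Z i\<close> by \<open>Ad h (Z i)\<close>, as the lift covers \<open>Ad\<close>. So \<open>\<D>\<psi> (g h)\<close> is
  \<open>\<kappa> (h\<^sup>-\<^sup>1)\<close> applied to the same expression formed with the orthonormal basis \<open>Ad h (Z i)\<close> in the
  derivative and Clifford slots; the form \<open>ip [X, Y]\<^sub>\<mm> W\<close> is trilinear and \<open>Ad H\<close>-invariant, hence this
  is \<open>\<D>\<psi> g\<close>.\<close>


section \<open>Calculus of smooth maps\<close>

text \<open>On an open set the derivative at a point depends only on nearby values, so the
  derivatives of \<open>f\<close> and \<open>g\<close> agree on \<open>S\<close> as well and the
  induction continues with them.\<close>

lemma times_differentiable_on_cong:
  assumes "open S" "\<And>x. x \<in> S \<Longrightarrow> f x = g x" "times_differentiable_on k S f"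
  shows "times_differentiable_on k S g"
  using assms(2,3)
proof (induction k arbitrary: f g)
  case 0
  then show ?case by (simp cong: continuous_on_cong)
next
  case (Suc k)
  have "g differentiable at x \<and> frechet_derivative f (at x) = frechet_derivative g (at x)"
    if x: "x \<in> S" for x
  proof -
    have f: "(f has_derivative frechet_derivative f (at x)) (at x)"
      using Suc.prems x by (simp add: frechet_derivative_works)
    then have "(g has_derivative frechet_derivative f (at x)) (at x)"
      using has_derivative_transform_within_open[OF f assms(1) x] Suc.prems(1) by auto
    then show ?thesis
      using frechet_derivative_at differentiableI by blast
  qed
  then show ?case
    using Suc.prems(2) Suc.IH[of "\<lambda>x. frechet_derivative f (at x) v" "\<lambda>x. frechet_derivative g (at x) v" for v]
    by simp
qed

text \<open>Allows any explicit derivative \<open>f'\<close> in place of the choice-based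
  \<open>frechet_derivative\<close>; the product rule and the chain rule below enter in this
  way.\<close>

lemma times_differentiable_on_SucI:
  assumes "open S" and d: "\<And>x. x \<in> S \<Longrightarrow> (f has_derivative f' x) (at x)"
    and "\<And>v. times_differentiable_on k S (\<lambda>x. f' x v)"
  shows "times_differentiable_on (Suc k) S f"
proof -
  have "times_differentiable_on k S (\<lambda>x. frechet_derivative f (at x) v)" for v
    by (rule times_differentiable_on_cong[OF assms(1) _ assms(3)[of v]])
      (metis d frechet_derivative_at)
  then show ?thesis
    using d unfolding times_differentiable_on.simps by (blast intro: differentiableI)
qed

lemma times_differentiable_on_SucD:
  "times_differentiable_on (Suc k) S f \<Longrightarrow> times_differentiable_on k S f"
  by (induction k arbitrary: f)
    (auto intro!: continuous_at_imp_continuous_on differentiable_imp_continuous_within)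

text \<open>Needed because smoothness of a translated function can only be tested near each point,
  with a target chart that depends on the point.\<close>

lemma times_differentiable_on_local:
  assumes "\<And>x. x \<in> S \<Longrightarrow> \<exists>T. open T \<and> x \<in> T \<and> times_differentiable_on k T f"
  shows "times_differentiable_on k S f"
  using assms
proof (induction k arbitrary: f)
  case 0
  then show ?case
    by (auto intro!: continuous_at_imp_continuous_on simp: continuous_on_eq_continuous_at)
       (metis continuous_on_eq_continuous_at)
next
  case (Suc k)
  then show ?case by fastforce
qed

lemma times_differentiable_on_const: "times_differentiable_on k S (\<lambda>x. c)"
  by (induction k arbitrary: c) (simp_all add: frechet_derivative_const)

lemma times_differentiable_on_bounded_linear:
  assumes L: "bounded_linear L" and S: "open S" and f: "times_differentiable_on k S f"
  shows "times_differentiable_on k S (\<lambda>x. L (f x))"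
  using f
proof (induction k arbitrary: f)
  case 0
  then show ?case by (simp add: bounded_linear.continuous_on[OF L])
next
  case (Suc k)
  have d: "((\<lambda>x. L (f x)) has_derivative (\<lambda>v. L (frechet_derivative f (at x) v))) (at x)"
    if "x \<in> S" for x
    using Suc.prems that by (intro bounded_linear.has_derivative[OF L]) (simp add: frechet_derivative_works)
  have "times_differentiable_on k S (\<lambda>x. L (frechet_derivative f (at x) v))" for v
    using Suc by simp
  from S d this show ?case by (rule times_differentiable_on_SucI)
qed

lemma times_differentiable_on_add:
  assumes S: "open S" and f: "times_differentiable_on k S f" and g: "times_differentiable_on k S g"
  shows "times_differentiable_on k S (\<lambda>x. f x + g x)"
  using f g
proof (induction k arbitrary: f g)
  case 0
  then show ?case by (simp add: continuous_on_add)
next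
  case (Suc k)
  have d: "((\<lambda>x. f x + g x) has_derivative
      (\<lambda>v. frechet_derivative f (at x) v + frechet_derivative g (at x) v)) (at x)"
    if "x \<in> S" for x
    using Suc.prems that by (intro has_derivative_add) (simp_all add: frechet_derivative_works)
  have "times_differentiable_on k S (\<lambda>x. frechet_derivative f (at x) v + frechet_derivative g (at x) v)" for v
    using Suc by simp
  from S d this show ?case by (rule times_differentiable_on_SucI)
qed

lemma times_differentiable_on_sum:
  assumes "open S" "\<And>i. i \<in> I \<Longrightarrow> times_differentiable_on k S (f i)"
  shows "times_differentiable_on k S (\<lambda>x. \<Sum>i\<in>I. f i x)"
  using assms(2)
  by (induction I rule: infinite_finite_induct)
    (simp_all add: times_differentiable_on_const times_differentiable_on_add[OF assms(1)])

text \<open>Leibniz rule: each summand of the derivative contains one differentiated factor, and the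
  other factor is lowered to order \<open>k\<close> so that the induction hypothesis fits
  both.\<close>

lemma times_differentiable_on_bilinear:
  assumes B: "bounded_bilinear B" and S: "open S"
    and f: "times_differentiable_on k S f" and g: "times_differentiable_on k S g"
  shows "times_differentiable_on k S (\<lambda>x. B (f x) (g x))"
  using f g
proof (induction k arbitrary: f g)
  case 0
  then show ?case by (simp add: bounded_bilinear.continuous_on[OF B])
next
  case (Suc k)
  have d: "((\<lambda>x. B (f x) (g x)) has_derivative
      (\<lambda>v. B (f x) (frechet_derivative g (at x) v) + B (frechet_derivative f (at x) v) (g x))) (at x)"
    if "x \<in> S" for x
    using Suc.prems that by (intro bounded_bilinear.FDERIV[OF B]) (simp_all add: frechet_derivative_works)
  have "times_differentiable_on k S
      (\<lambda>x. B (f x) (frechet_derivative g (at x) v) + B (frechet_derivative f (at x) v) (g x))" for v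
    using Suc times_differentiable_on_SucD[OF Suc.prems(1)] times_differentiable_on_SucD[OF Suc.prems(2)]
    by (intro times_differentiable_on_add[OF S] Suc.IH) auto
  from S d this show ?case by (rule times_differentiable_on_SucI)
qed

text \<open>\<open>times_differentiable_on\<close> speaks of derivatives in a fixed direction.
  Linearity of the derivative turns a direction that varies with the point into a sum over fixed
  directions with scalar coefficients.\<close>

lemma frechet_derivative_Basis_expansion:
  fixes f :: "'a::euclidean_space \<Rightarrow> 'b::real_normed_vector"
  assumes "f differentiable at x"
  shows "frechet_derivative f (at x) v = (\<Sum>b\<in>Basis. (v \<bullet> b) *\<^sub>R frechet_derivative f (at x) b)"
proof -
  have l: "linear (frechet_derivative f (at x))"
    using assms linear_frechet_derivative by blast
  have "frechet_derivative f (at x) (\<Sum>b\<in>Basis. (v \<bullet> b) *\<^sub>R b)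
      = (\<Sum>b\<in>Basis. (v \<bullet> b) *\<^sub>R frechet_derivative f (at x) b)"
    by (simp add: linear_sum[OF l] linear_scale[OF l])
  then show ?thesis by (simp add: euclidean_representation)
qed

lemma times_differentiable_on_compose:
  fixes g :: "'a::real_normed_vector \<Rightarrow> 'b::euclidean_space" and f :: "'b \<Rightarrow> 'c::real_normed_vector"
  assumes S: "open S" and gS: "g ` S \<subseteq> T"
    and f: "times_differentiable_on k T f" and g: "times_differentiable_on k S g"
  shows "times_differentiable_on k S (\<lambda>x. f (g x))"
  using f g
proof (induction k arbitrary: f)
  case 0
  then show ?case using continuous_on_compose2 gS by auto
next
  case (Suc k)
  have df: "f differentiable at (g x)" if "x \<in> S" for x
    using Suc.prems(1) gS that by auto
  \<comment> \<open>The chain rule in expanded form: the induction hypothesis applies to the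
    derivatives of \<open>f\<close> in the fixed directions \<open>b\<close>, and the product rule
    does the rest.\<close>
  have d: "((\<lambda>x. f (g x)) has_derivative
      (\<lambda>v. \<Sum>b\<in>Basis. (frechet_derivative g (at x) v \<bullet> b) *\<^sub>R frechet_derivative f (at (g x)) b)) (at x)"
    if x: "x \<in> S" for x
  proof -
    have "(g has_derivative frechet_derivative g (at x)) (at x)"
      using Suc.prems(2) x by (simp add: frechet_derivative_works)
    from has_derivative_compose[OF this] df[OF x]
    have "((\<lambda>x. f (g x)) has_derivative
      (\<lambda>v. frechet_derivative f (at (g x)) (frechet_derivative g (at x) v))) (at x)"
      by (simp add: frechet_derivative_works)
    moreover have "frechet_derivative f (at (g x)) (frechet_derivative g (at x) v) =
        (\<Sum>b\<in>Basis. (frechet_derivative g (at x) v \<bullet> b) *\<^sub>R frechet_derivative f (at (g x)) b)" for v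
      by (rule frechet_derivative_Basis_expansion[OF df[OF x]])
    ultimately show ?thesis by (simp only:)
  qed
  have "times_differentiable_on k S
      (\<lambda>x. \<Sum>b\<in>Basis. (frechet_derivative g (at x) v \<bullet> b) *\<^sub>R frechet_derivative f (at (g x)) b)" for v
    using Suc times_differentiable_on_SucD[OF Suc.prems(2)]
    by (intro times_differentiable_on_sum[OF S] times_differentiable_on_bilinear[OF bounded_bilinear_scaleR S]
        times_differentiable_on_bounded_linear[OF bounded_linear_inner_left S]) auto
  from S d this show ?case by (rule times_differentiable_on_SucI)
qed

text \<open>The derivative is \<open>L\<close> at every point, hence constant in \<open>x\<close>.
  The lemma serves for slice maps such as \<open>p \<mapsto> (c, p)\<close> into a product.\<close>

lemma times_differentiable_on_bounded_linear_plus_const: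
  assumes L: "bounded_linear L" and S: "open S"
  shows "times_differentiable_on k S (\<lambda>x. L x + c)"
proof (cases k)
  case 0
  then show ?thesis
    by (simp add: continuous_on_add linear_continuous_on[OF L])
next
  case (Suc l)
  have "((\<lambda>x. L x + c) has_derivative L) (at x)" for x
    by (intro has_derivative_add_const bounded_linear_imp_has_derivative L)
  then show ?thesis
    unfolding Suc by (rule times_differentiable_on_SucI[OF S]) (rule times_differentiable_on_const)
qed

section \<open>Smooth functions: the same rules for all orders at once\<close>

lemma smooth_on_imp_differentiable: "smooth_on S f \<Longrightarrow> x \<in> S \<Longrightarrow> f differentiable at x"
  unfolding smooth_on_def by (metis times_differentiable_on.simps(2))

lemma smooth_on_frechet_derivative:
  "smooth_on S f \<Longrightarrow> smooth_on S (\<lambda>x. frechet_derivative f (at x) v)"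
  unfolding smooth_on_def by (metis times_differentiable_on.simps(2))

lemma smooth_on_cong:
  "open S \<Longrightarrow> (\<And>x. x \<in> S \<Longrightarrow> f x = g x) \<Longrightarrow> smooth_on S f \<Longrightarrow> smooth_on S g"
  unfolding smooth_on_def using times_differentiable_on_cong by blast

lemma smooth_on_local:
  "(\<And>x. x \<in> S \<Longrightarrow> \<exists>T. open T \<and> x \<in> T \<and> smooth_on T f) \<Longrightarrow> smooth_on S f"
  unfolding smooth_on_def by (metis times_differentiable_on_local)

lemma smooth_on_const: "smooth_on S (\<lambda>x. c)"
  unfolding smooth_on_def using times_differentiable_on_const by blast

lemma smooth_on_bounded_linear:
  "bounded_linear L \<Longrightarrow> open S \<Longrightarrow> smooth_on S f \<Longrightarrow> smooth_on S (\<lambda>x. L (f x))"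
  unfolding smooth_on_def using times_differentiable_on_bounded_linear by blast

lemma smooth_on_bounded_linear_plus_const:
  "bounded_linear L \<Longrightarrow> open S \<Longrightarrow> smooth_on S (\<lambda>x. L x + c)"
  unfolding smooth_on_def using times_differentiable_on_bounded_linear_plus_const by blast

lemma smooth_on_sum:
  "open S \<Longrightarrow> (\<And>i. i \<in> I \<Longrightarrow> smooth_on S (f i)) \<Longrightarrow> smooth_on S (\<lambda>x. \<Sum>i\<in>I. f i x)"
  unfolding smooth_on_def by (simp add: times_differentiable_on_sum)

lemma smooth_on_scaleR:
  "open S \<Longrightarrow> smooth_on S f \<Longrightarrow> smooth_on S g \<Longrightarrow> smooth_on S (\<lambda>x. f x *\<^sub>R g x)"
  unfolding smooth_on_def using times_differentiable_on_bilinear[OF bounded_bilinear_scaleR] by blast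

lemma smooth_on_compose:
  fixes g :: "'a::real_normed_vector \<Rightarrow> 'b::euclidean_space"
  shows "open S \<Longrightarrow> g ` S \<subseteq> T \<Longrightarrow> smooth_on T f \<Longrightarrow> smooth_on S g \<Longrightarrow> smooth_on S (\<lambda>x. f (g x))"
  unfolding smooth_on_def using times_differentiable_on_compose by blast


section \<open>Vector fields and translations\<close>

context lie_group
begin

section \<open>Charts, and vector fields read in charts\<close>

lemma chart_open: "(U, \<phi>) \<in> A \<Longrightarrow> open U" "(U, \<phi>) \<in> A \<Longrightarrow> open (\<phi> ` U)"
  and chart_homeomorphism: "(U, \<phi>) \<in> A \<Longrightarrow> homeomorphism U (\<phi> ` U) \<phi> (inv_into U \<phi>)"
  using atlas unfolding smooth_atlas_def by fast+

lemma chart_inv [simp]: "(U, \<phi>) \<in> A \<Longrightarrow> x \<in> U \<Longrightarrow> inv_into U \<phi> (\<phi> x) = x"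
  using chart_homeomorphism homeomorphism_apply1 by blast

lemma obtain_chart: obtains U \<phi> where "(U, \<phi>) \<in> A" "x \<in> U"
proof -
  have "(\<Union>(U, \<phi>)\<in>A. U) = UNIV"
    using atlas by (simp add: smooth_atlas_def)
  then show ?thesis using that by blast
qed

lemma chart_image_open:
  assumes c: "(U, \<phi>) \<in> A" and W: "open W"
  shows "open (\<phi> ` (U \<inter> W))"
proof -
  have "\<phi> ` (U \<inter> W) = \<phi> ` U \<inter> inv_into U \<phi> -` W"
    using c by auto
  moreover have "continuous_on (\<phi> ` U) (inv_into U \<phi>)"
    using chart_homeomorphism[OF c] by (simp add: homeomorphism_def)
  ultimately show ?thesis
    using chart_open(2)[OF c] W continuous_open_preimage by metis
qed

lemma smooth_map_chart: "smooth_map A f \<Longrightarrow> (U, \<phi>) \<in> A \<Longrightarrow> smooth_on (\<phi> ` U) (f \<circ> inv_into U \<phi>)"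
  unfolding smooth_map_def by blast

lemma smooth_map_chart_differentiable:
  "smooth_map A f \<Longrightarrow> (U, \<phi>) \<in> A \<Longrightarrow> x \<in> U \<Longrightarrow> (f \<circ> inv_into U \<phi>) differentiable at (\<phi> x)"
  using smooth_map_chart smooth_on_imp_differentiable by blast

lemma smooth_map_bounded_linear:
  assumes "bounded_linear L" "smooth_map A \<psi>"
  shows "smooth_map A (\<lambda>x. L (\<psi> x))"
  using assms chart_open(2) smooth_on_bounded_linear[OF assms(1), of "\<phi> ` U" "\<psi> \<circ> inv_into U \<phi>" for U \<phi>]
  unfolding smooth_map_def comp_def by fast

lemma smooth_map_sum:
  assumes "\<And>i. i \<in> I \<Longrightarrow> smooth_map A (\<psi> i)"
  shows "smooth_map A (\<lambda>x. \<Sum>i\<in>I. \<psi> i x)"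
proof -
  have "smooth_on (\<phi> ` U) (\<lambda>p. \<Sum>i\<in>I. (\<psi> i \<circ> inv_into U \<phi>) p)" if "(U, \<phi>) \<in> A" for U \<phi>
    by (intro smooth_on_sum chart_open[OF that] smooth_map_chart[OF assms that])
  then show ?thesis unfolding smooth_map_def comp_def by blast
qed

text \<open>Vector fields are defined on real valued functions only. Taking components commutes with
  differentiation, so the chart formula carries over to vector valued maps, with one coefficient
  \<open>a\<close> that serves every \<open>\<psi>\<close>.\<close>

lemma vector_field_chart:
  assumes X: "smooth_vector_field A X" and c: "(U, \<phi>) \<in> A"
  obtains a where "smooth_on (\<phi> ` U) a"
    "\<And>\<psi> x. smooth_map A (\<psi> :: 'g \<Rightarrow> 'v::euclidean_space) \<Longrightarrow> x \<in> U \<Longrightarrow>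
       vderiv X \<psi> x = frechet_derivative (\<psi> \<circ> inv_into U \<phi>) (at (\<phi> x)) (a (\<phi> x))"
proof -
  obtain a where a: "smooth_on (\<phi> ` U) a" and
    Xa: "\<And>f x. smooth_map A f \<Longrightarrow> x \<in> U \<Longrightarrow>
      X f x = frechet_derivative (f \<circ> inv_into U \<phi>) (at (\<phi> x)) (a (\<phi> x))"
    using X c unfolding smooth_vector_field_def by fast
  have "vderiv X \<psi> x = frechet_derivative (\<psi> \<circ> inv_into U \<phi>) (at (\<phi> x)) (a (\<phi> x))"
    if \<psi>: "smooth_map A \<psi>" and x: "x \<in> U" for \<psi> :: "'g \<Rightarrow> 'v" and x
  proof -
    let ?F = "frechet_derivative (\<psi> \<circ> inv_into U \<phi>) (at (\<phi> x))"
    have d: "((\<psi> \<circ> inv_into U \<phi>) has_derivative ?F) (at (\<phi> x))"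
      using smooth_map_chart_differentiable[OF \<psi> c x] by (simp add: frechet_derivative_works)
    have "X (\<lambda>y. \<psi> y \<bullet> b) x = ?F (a (\<phi> x)) \<bullet> b" for b
    proof -
      have "((\<lambda>y. (\<psi> \<circ> inv_into U \<phi>) y \<bullet> b) has_derivative (\<lambda>v. ?F v \<bullet> b)) (at (\<phi> x))"
        using bounded_linear.has_derivative[OF bounded_linear_inner_left d] .
      then have "frechet_derivative ((\<lambda>y. \<psi> y \<bullet> b) \<circ> inv_into U \<phi>) (at (\<phi> x)) = (\<lambda>v. ?F v \<bullet> b)"
        using frechet_derivative_at unfolding comp_def by metis
      then show ?thesis
        using Xa[OF smooth_map_bounded_linear[OF bounded_linear_inner_left \<psi>] x] by simp
    qed
    then show ?thesis
      unfolding vderiv_def by (simp add: euclidean_representation)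
  qed
  with a that show ?thesis by blast
qed

text \<open>In a chart the result is a sum of products of the smooth components of \<open>a\<close>
  with partial derivatives of a smooth map.\<close>

lemma smooth_map_vderiv:
  fixes \<psi> :: "'g \<Rightarrow> 'v::euclidean_space"
  assumes X: "smooth_vector_field A X" and \<psi>: "smooth_map A \<psi>"
  shows "smooth_map A (vderiv X \<psi>)"
proof -
  have "smooth_on (\<phi> ` U) (vderiv X \<psi> \<circ> inv_into U \<phi>)" if c: "(U, \<phi>) \<in> A" for U \<phi>
  proof -
    let ?\<psi> = "\<psi> \<circ> inv_into U \<phi>"
    obtain a where a: "smooth_on (\<phi> ` U) a"
      and Xa: "\<And>x. x \<in> U \<Longrightarrow> vderiv X \<psi> x = frechet_derivative ?\<psi> (at (\<phi> x)) (a (\<phi> x))"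
      using vector_field_chart[OF X c] \<psi> by metis
    note o = chart_open(2)[OF c]
    show ?thesis
    proof (rule smooth_on_cong[OF o])
      show "smooth_on (\<phi> ` U) (\<lambda>p. \<Sum>b\<in>Basis. (a p \<bullet> b) *\<^sub>R frechet_derivative ?\<psi> (at p) b)"
        by (intro smooth_on_sum smooth_on_scaleR o smooth_on_frechet_derivative smooth_map_chart \<psi> c
            smooth_on_bounded_linear[OF bounded_linear_inner_left] a)
      show "(\<Sum>b\<in>Basis. (a p \<bullet> b) *\<^sub>R frechet_derivative ?\<psi> (at p) b) = (vderiv X \<psi> \<circ> inv_into U \<phi>) p"
        if "p \<in> \<phi> ` U" for p
        using that c Xa frechet_derivative_Basis_expansion[OF smooth_map_chart_differentiable[OF \<psi> c]]
        by auto
    qed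
  qed
  then show ?thesis unfolding smooth_map_def by blast
qed

text \<open>The components of \<open>L \<circ> \<psi>\<close> are constant linear combinations of
  those of \<open>\<psi>\<close>, and the chart formula makes \<open>X\<close> linear on smooth
  functions.\<close>

lemma vderiv_bounded_linear:
  fixes \<psi> :: "'g \<Rightarrow> 'v::euclidean_space" and L :: "'v \<Rightarrow> 'w::euclidean_space"
  assumes X: "smooth_vector_field A X" and \<psi>: "smooth_map A \<psi>" and L: "bounded_linear L"
  shows "vderiv X (\<lambda>y. L (\<psi> y)) x = L (vderiv X \<psi> x)"
proof -
  obtain U \<phi> where c: "(U, \<phi>) \<in> A" and x: "x \<in> U" by (rule obtain_chart)
  obtain a where Xa: "\<And>f x. smooth_map A f \<Longrightarrow> x \<in> U \<Longrightarrow>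
      X f x = frechet_derivative (f \<circ> inv_into U \<phi>) (at (\<phi> x)) (a (\<phi> x))"
    using X c unfolding smooth_vector_field_def by fast
  have lin: "X (\<lambda>y. L (\<psi> y) \<bullet> b) x = L (vderiv X \<psi> x) \<bullet> b" for b
  proof -
    let ?F = "\<lambda>c. frechet_derivative ((\<lambda>y. \<psi> y \<bullet> c) \<circ> inv_into U \<phi>) (at (\<phi> x))"
    have sm: "smooth_map A (\<lambda>y. \<psi> y \<bullet> c)" for c
      by (rule smooth_map_bounded_linear[OF bounded_linear_inner_left \<psi>])
    have expand: "L v \<bullet> b = (\<Sum>c\<in>Basis. (v \<bullet> c) * (L c \<bullet> b))" for v
    proof -
      have "L v = L (\<Sum>c\<in>Basis. (v \<bullet> c) *\<^sub>R c)" by (simp add: euclidean_representation)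
      also have "\<dots> = (\<Sum>c\<in>Basis. (v \<bullet> c) *\<^sub>R L c)"
        using bounded_linear.linear[OF L] by (simp add: linear_sum linear_scale)
      finally show ?thesis by (simp add: inner_sum_left)
    qed
    have d: "((\<lambda>p. \<Sum>c\<in>Basis. ((\<lambda>y. \<psi> y \<bullet> c) \<circ> inv_into U \<phi>) p * (L c \<bullet> b)) has_derivative
        (\<lambda>v. \<Sum>c\<in>Basis. ?F c v * (L c \<bullet> b))) (at (\<phi> x))"
      using smooth_map_chart_differentiable[OF sm c x]
      by (intro has_derivative_sum has_derivative_mult_left) (simp only: frechet_derivative_works)
    have eq: "(\<lambda>y. L (\<psi> y) \<bullet> b) \<circ> inv_into U \<phi>
        = (\<lambda>p. \<Sum>c\<in>Basis. ((\<lambda>y. \<psi> y \<bullet> c) \<circ> inv_into U \<phi>) p * (L c \<bullet> b))"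
      unfolding comp_def by (rule ext) (rule expand)
    have "frechet_derivative ((\<lambda>y. L (\<psi> y) \<bullet> b) \<circ> inv_into U \<phi>) (at (\<phi> x))
        = (\<lambda>v. \<Sum>c\<in>Basis. ?F c v * (L c \<bullet> b))"
      unfolding eq by (rule frechet_derivative_at[OF d, symmetric])
    moreover have "smooth_map A (\<lambda>y. L (\<psi> y) \<bullet> b)"
      using smooth_map_bounded_linear[OF bounded_linear_inner_left smooth_map_bounded_linear[OF L \<psi>]] .
    ultimately have "X (\<lambda>y. L (\<psi> y) \<bullet> b) x = (\<Sum>c\<in>Basis. X (\<lambda>y. \<psi> y \<bullet> c) x * (L c \<bullet> b))"
      using Xa x sm by simp
    also have "\<dots> = L (vderiv X \<psi> x) \<bullet> b"
      unfolding expand[of "vderiv X \<psi> x"]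
      by (intro sum.cong) (auto simp: vderiv_def inner_sum_left inner_Basis if_distrib cong: if_cong)
    finally show ?thesis .
  qed
  show ?thesis
    by (subst (1) vderiv_def) (simp add: lin euclidean_representation)
qed

section \<open>Smoothness under left and right translations\<close>

lemma smooth_map_translate:
  fixes f :: "'g \<Rightarrow> 'v::real_normed_vector"
  assumes f: "smooth_map A f" and \<tau>: "continuous_on UNIV \<tau>"
    and smooth: "\<And>V \<theta> W \<omega> x. (V, \<theta>) \<in> A \<Longrightarrow> (W, \<omega>) \<in> A \<Longrightarrow> x \<in> V \<Longrightarrow> \<tau> x \<in> W \<Longrightarrow>
      smooth_on (\<theta> ` (V \<inter> \<tau> -` W)) (\<lambda>p. \<omega> (\<tau> (inv_into V \<theta> p)))"
  shows "smooth_map A (\<lambda>x. f (\<tau> x))"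
proof -
  have "smooth_on (\<theta> ` V) ((\<lambda>x. f (\<tau> x)) \<circ> inv_into V \<theta>)" if c: "(V, \<theta>) \<in> A" for V \<theta>
  proof (rule smooth_on_local)
    fix p assume "p \<in> \<theta> ` V"
    then obtain x where x: "x \<in> V" "p = \<theta> x" by blast
    obtain W \<omega> where d: "(W, \<omega>) \<in> A" and W: "\<tau> x \<in> W" by (rule obtain_chart)
    \<comment> \<open>One chart \<open>W\<close> need not contain the whole image of
      \<open>V\<close>, so smoothness is checked near each point, on the part of \<open>V\<close>
      that \<open>\<tau>\<close> sends into \<open>W\<close>.\<close>
    let ?T = "\<theta> ` (V \<inter> \<tau> -` W)"
    have o: "open ?T"
      using chart_image_open[OF c] open_vimage[OF chart_open(1)[OF d] \<tau>] by blast
    have "smooth_on ?T (\<lambda>p. (f \<circ> inv_into W \<omega>) (\<omega> (\<tau> (inv_into V \<theta> p))))"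
      by (rule smooth_on_compose[OF o _ smooth_map_chart[OF f d] smooth[OF c d x(1) W]])
        (auto simp: c)
    then have "smooth_on ?T ((\<lambda>x. f (\<tau> x)) \<circ> inv_into V \<theta>)"
      by (rule smooth_on_cong[OF o, rotated]) (auto simp: c d)
    then show "\<exists>T. open T \<and> p \<in> T \<and> smooth_on T ((\<lambda>x. f (\<tau> x)) \<circ> inv_into V \<theta>)"
      using o x W by blast
  qed
  then show ?thesis unfolding smooth_map_def by blast
qed

lemma continuous_left_mult: "continuous_on UNIV (\<lambda>x. g \<otimes>\<^bsub>G\<^esub> x)"
  and continuous_right_mult: "continuous_on UNIV (\<lambda>x. x \<otimes>\<^bsub>G\<^esub> g)"
  using continuous_on_compose2[OF continuous_mult, of UNIV "\<lambda>x. (g, x)"]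
    continuous_on_compose2[OF continuous_mult, of UNIV "\<lambda>x. (x, g)"]
  by (simp_all add: continuous_on_Pair)

text \<open>Freezing the first factor of the smooth multiplication: in charts, left translation by
  \<open>g\<close> is multiplication restricted to the affine slice
  \<open>p \<mapsto> (\<phi> g, p)\<close>.\<close>

lemma smooth_map_left_mult:
  assumes "smooth_map A f"
  shows "smooth_map A (\<lambda>x. f (g \<otimes>\<^bsub>G\<^esub> x))"
proof (rule smooth_map_translate[OF assms continuous_left_mult])
  fix V \<theta> W \<omega> x assume V: "(V, \<theta>) \<in> A" and W: "(W, \<omega>) \<in> A" and "x \<in> V" "g \<otimes>\<^bsub>G\<^esub> x \<in> W"
  obtain U \<phi> where U: "(U, \<phi>) \<in> A" "g \<in> U" by (rule obtain_chart)
  let ?S = "\<theta> ` (V \<inter> (\<lambda>x. g \<otimes>\<^bsub>G\<^esub> x) -` W)"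
  have "open ?S"
    using chart_image_open[OF V] open_vimage[OF chart_open(1)[OF W] continuous_left_mult] by blast
  moreover have "(\<lambda>p. (\<phi> g, p)) ` ?S \<subseteq> {(\<phi> x, \<theta> y) | x y. x \<in> U \<and> y \<in> V \<and> x \<otimes>\<^bsub>G\<^esub> y \<in> W}"
    using U by blast
  moreover have "smooth_on {(\<phi> x, \<theta> y) | x y. x \<in> U \<and> y \<in> V \<and> x \<otimes>\<^bsub>G\<^esub> y \<in> W}
            (\<lambda>p. \<omega> (inv_into U \<phi> (fst p) \<otimes>\<^bsub>G\<^esub> inv_into V \<theta> (snd p)))"
    using smooth_mult U(1) V W by fast
  moreover have "smooth_on ?S (\<lambda>p. (\<phi> g, p))"
    using smooth_on_bounded_linear_plus_const[of "\<lambda>p. (0, p)" ?S "(\<phi> g, 0)"] calculation(1)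
    by (simp add: bounded_linear_Pair)
  ultimately have "smooth_on ?S (\<lambda>p. \<omega> (inv_into U \<phi> (fst (\<phi> g, p)) \<otimes>\<^bsub>G\<^esub> inv_into V \<theta> (snd (\<phi> g, p))))"
    by (rule smooth_on_compose)
  then show "smooth_on ?S (\<lambda>p. \<omega> (g \<otimes>\<^bsub>G\<^esub> inv_into V \<theta> p))"
    using U by simp
qed

lemma smooth_map_right_mult:
  assumes "smooth_map A f"
  shows "smooth_map A (\<lambda>x. f (x \<otimes>\<^bsub>G\<^esub> g))"
proof (rule smooth_map_translate[OF assms continuous_right_mult])
  fix V \<theta> W \<omega> x assume V: "(V, \<theta>) \<in> A" and W: "(W, \<omega>) \<in> A" and "x \<in> V" "x \<otimes>\<^bsub>G\<^esub> g \<in> W"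
  obtain U \<phi> where U: "(U, \<phi>) \<in> A" "g \<in> U" by (rule obtain_chart)
  let ?S = "\<theta> ` (V \<inter> (\<lambda>x. x \<otimes>\<^bsub>G\<^esub> g) -` W)"
  have "open ?S"
    using chart_image_open[OF V] open_vimage[OF chart_open(1)[OF W] continuous_right_mult] by blast
  moreover have "(\<lambda>p. (p, \<phi> g)) ` ?S \<subseteq> {(\<theta> x, \<phi> y) | x y. x \<in> V \<and> y \<in> U \<and> x \<otimes>\<^bsub>G\<^esub> y \<in> W}"
    using U by blast
  moreover have "smooth_on {(\<theta> x, \<phi> y) | x y. x \<in> V \<and> y \<in> U \<and> x \<otimes>\<^bsub>G\<^esub> y \<in> W}
            (\<lambda>p. \<omega> (inv_into V \<theta> (fst p) \<otimes>\<^bsub>G\<^esub> inv_into U \<phi> (snd p)))"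
    using smooth_mult U(1) V W by fast
  moreover have "smooth_on ?S (\<lambda>p. (p, \<phi> g))"
    using smooth_on_bounded_linear_plus_const[of "\<lambda>p. (p, 0)" ?S "(0, \<phi> g)"] calculation(1)
    by (simp add: bounded_linear_Pair)
  ultimately have "smooth_on ?S (\<lambda>p. \<omega> (inv_into V \<theta> (fst (p, \<phi> g)) \<otimes>\<^bsub>G\<^esub> inv_into U \<phi> (snd (p, \<phi> g))))"
    by (rule smooth_on_compose)
  then show "smooth_on ?S (\<lambda>p. \<omega> (inv_into V \<theta> p \<otimes>\<^bsub>G\<^esub> g))"
    using U by simp
qed

section \<open>Left invariance, the adjoint action and one-parameter subgroups\<close>

declare carrier_UNIV [simp]

lemma lie_algebra_smooth: "X \<in> lie_algebra G A \<Longrightarrow> smooth_vector_field A X"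
  unfolding lie_algebra_def by blast

lemma lie_algebra_left_invariant:
  "X \<in> lie_algebra G A \<Longrightarrow> smooth_map A f \<Longrightarrow> X (\<lambda>y. f (g \<otimes>\<^bsub>G\<^esub> y)) x = X f (g \<otimes>\<^bsub>G\<^esub> x)"
  unfolding lie_algebra_def by blast

lemma vderiv_left_mult:
  fixes \<psi> :: "'g \<Rightarrow> 'v::euclidean_space"
  assumes "X \<in> lie_algebra G A" "smooth_map A \<psi>"
  shows "vderiv X (\<lambda>y. \<psi> (g \<otimes>\<^bsub>G\<^esub> y)) x = vderiv X \<psi> (g \<otimes>\<^bsub>G\<^esub> x)"
  unfolding vderiv_def
  by (simp add: lie_algebra_left_invariant[OF assms(1) smooth_map_bounded_linear[OF bounded_linear_inner_left assms(2)]])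

lemma conjugate_cancel:
  "inv\<^bsub>G\<^esub> h \<otimes>\<^bsub>G\<^esub> (h \<otimes>\<^bsub>G\<^esub> y \<otimes>\<^bsub>G\<^esub> inv\<^bsub>G\<^esub> h) \<otimes>\<^bsub>G\<^esub> h = y"
  "h \<otimes>\<^bsub>G\<^esub> (inv\<^bsub>G\<^esub> h \<otimes>\<^bsub>G\<^esub> x \<otimes>\<^bsub>G\<^esub> h) = x \<otimes>\<^bsub>G\<^esub> h"
  "h \<otimes>\<^bsub>G\<^esub> y \<otimes>\<^bsub>G\<^esub> inv\<^bsub>G\<^esub> h \<otimes>\<^bsub>G\<^esub> h = h \<otimes>\<^bsub>G\<^esub> y"
  by (simp_all add: m_assoc) (simp_all add: m_assoc[symmetric])

text \<open>Conjugation by \<open>h\<close> followed by right multiplication by \<open>h\<close> is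
  left multiplication by \<open>h\<close>, under which \<open>X\<close> is invariant.\<close>

lemma Ad_right_mult:
  assumes "X \<in> lie_algebra G A" "smooth_map A f"
  shows "Ad G h X (\<lambda>y. f (y \<otimes>\<^bsub>G\<^esub> h)) x = X f (x \<otimes>\<^bsub>G\<^esub> h)"
  unfolding Ad_def conjugate_cancel(3) lie_algebra_left_invariant[OF assms] conjugate_cancel(2) ..

lemma vderiv_Ad_right_mult:
  fixes \<psi> :: "'g \<Rightarrow> 'v::euclidean_space"
  assumes "X \<in> lie_algebra G A" "smooth_map A \<psi>"
  shows "vderiv X \<psi> (x \<otimes>\<^bsub>G\<^esub> h) = vderiv (Ad G h X) (\<lambda>y. \<psi> (y \<otimes>\<^bsub>G\<^esub> h)) x"
  unfolding vderiv_def
  by (simp add: Ad_right_mult[OF assms(1) smooth_map_bounded_linear[OF bounded_linear_inner_left assms(2)]])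

lemma Ad_add: "Ad G h (X + Y) = Ad G h X + Ad G h Y"
  by (simp add: Ad_def fun_eq_iff)

text \<open>\<open>Ad G h\<close> conjugates the operator \<open>X\<close> by the pullback along
  conjugation with \<open>h\<close>, so it respects composition of operators and hence
  commutators.\<close>

lemma Ad_lie_bracket: "Ad G h (lie_bracket X Y) = lie_bracket (Ad G h X) (Ad G h Y)"
  unfolding Ad_def lie_bracket_def conjugate_cancel by (simp add: fun_eq_iff)

text \<open>The one-parameter subgroup of \<open>Y\<close> conjugated by \<open>h\<close> stays in
  \<open>H\<close> and has velocity \<open>Ad G h Y\<close>. That \<open>Ad G h Y\<close> is a left
  invariant smooth field is a premise here, supplied by the caller.\<close>

lemma subgroup_lie_algebra_Ad:
  assumes H: "subgroup H G" and h: "h \<in> H" and Y: "Y \<in> subgroup_lie_algebra G A H"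
    and Ad: "Ad G h Y \<in> lie_algebra G A"
  shows "Ad G h Y \<in> subgroup_lie_algebra G A H"
proof -
  obtain \<gamma> where \<gamma>: "continuous_on UNIV \<gamma>" "\<And>s t. \<gamma> (s + t) = \<gamma> s \<otimes>\<^bsub>G\<^esub> \<gamma> t" "range \<gamma> \<subseteq> H"
    and d\<gamma>: "\<And>f t. smooth_map A f \<Longrightarrow> ((\<lambda>s. f (\<gamma> s)) has_real_derivative Y f (\<gamma> t)) (at t)"
    using Y unfolding subgroup_lie_algebra_def one_parameter_subgroup_def by blast
  let ?\<gamma> = "\<lambda>t. h \<otimes>\<^bsub>G\<^esub> \<gamma> t \<otimes>\<^bsub>G\<^esub> inv\<^bsub>G\<^esub> h"
  have "continuous_on UNIV ?\<gamma>"
    using continuous_on_compose2[OF continuous_right_mult continuous_on_compose2[OF continuous_left_mult \<gamma>(1)]]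
    by simp
  moreover have "?\<gamma> (s + t) = ?\<gamma> s \<otimes>\<^bsub>G\<^esub> ?\<gamma> t" for s t
  proof -
    have "inv\<^bsub>G\<^esub> h \<otimes>\<^bsub>G\<^esub> (h \<otimes>\<^bsub>G\<^esub> z) = z" for z
      by (simp add: m_assoc[symmetric])
    then show ?thesis by (simp add: \<gamma>(2) m_assoc)
  qed
  moreover have "((\<lambda>s. f (?\<gamma> s)) has_real_derivative Ad G h Y f (?\<gamma> t)) (at t)"
    if "smooth_map A f" for f t
    unfolding Ad_def conjugate_cancel
    using d\<gamma>[OF smooth_map_left_mult[OF smooth_map_right_mult[OF that]]] .
  moreover have "range ?\<gamma> \<subseteq> H"
    using H h \<gamma>(3) by (auto intro!: subgroup.m_closed subgroup.m_inv_closed)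
  ultimately show ?thesis
    using Ad unfolding subgroup_lie_algebra_def one_parameter_subgroup_def by blast
qed

text \<open>Running the one-parameter subgroup backwards reverses its velocity.\<close>

lemma subgroup_lie_algebra_uminus:
  assumes Y: "Y \<in> subgroup_lie_algebra G A H" and mY: "- Y \<in> lie_algebra G A"
  shows "- Y \<in> subgroup_lie_algebra G A H"
proof -
  obtain \<gamma> where \<gamma>: "continuous_on UNIV \<gamma>" "\<And>s t. \<gamma> (s + t) = \<gamma> s \<otimes>\<^bsub>G\<^esub> \<gamma> t" "range \<gamma> \<subseteq> H"
    and d\<gamma>: "\<And>f t. smooth_map A f \<Longrightarrow> ((\<lambda>s. f (\<gamma> s)) has_real_derivative Y f (\<gamma> t)) (at t)"
    using Y unfolding subgroup_lie_algebra_def one_parameter_subgroup_def by blast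
  have "continuous_on UNIV (\<lambda>t. \<gamma> (- t))"
    using continuous_on_compose2[OF \<gamma>(1) continuous_on_minus[OF continuous_on_id]] by simp
  moreover have "\<gamma> (- (s + t)) = \<gamma> (- s) \<otimes>\<^bsub>G\<^esub> \<gamma> (- t)" for s t
    using \<gamma>(2)[of "- s" "- t"] by simp
  moreover have "((\<lambda>s. f (\<gamma> (- s))) has_real_derivative (- Y) f (\<gamma> (- t))) (at t)"
    if "smooth_map A f" for f t
    using DERIV_chain2[OF d\<gamma>[OF that] DERIV_minus[OF DERIV_ident], of t] by simp
  moreover have "range (\<lambda>t. \<gamma> (- t)) \<subseteq> H"
    using \<gamma>(3) by blast
  ultimately show ?thesis
    using mY unfolding subgroup_lie_algebra_def one_parameter_subgroup_def by blast
qed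

end


section \<open>The torsion form of a naturally reductive space\<close>

context reductive_riemannian_homogeneous_space
begin

text \<open>Up to sign, the torsion of the canonical connection of the reductive space, with its
  last index lowered by the metric.\<close>

abbreviation torsion :: "'g vfield \<Rightarrow> 'g vfield \<Rightarrow> 'g vfield \<Rightarrow> real" where
  "torsion X Y W \<equiv> ip (m_part (subgroup_lie_algebra G A H) \<mm> (lie_bracket X Y)) W"

lemma m_subset: "X \<in> \<mm> \<Longrightarrow> X \<in> lie_algebra G A"
  and subgroup_lie_algebra_subset: "X \<in> subgroup_lie_algebra G A H \<Longrightarrow> X \<in> lie_algebra G A"
  using direct_sum unfolding is_direct_sum_def by blast+

lemma Ad_m: "h \<in> H \<Longrightarrow> X \<in> \<mm> \<Longrightarrow> Ad G h X \<in> \<mm>"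
  using Ad_H_m by blast

text \<open>Uniqueness in the direct sum makes the description in \<open>m_part\<close> proper, so
  exhibiting any decomposition determines its value.\<close>

lemma m_part_eqI:
  assumes "V \<in> lie_algebra G A" "W \<in> \<mm>" "Y \<in> subgroup_lie_algebra G A H" "V = Y + W"
  shows "m_part (subgroup_lie_algebra G A H) \<mm> V = W"
proof -
  have ex1: "\<exists>!p. fst p \<in> subgroup_lie_algebra G A H \<and> snd p \<in> \<mm> \<and> V = fst p + snd p"
    using direct_sum assms(1) unfolding is_direct_sum_def by blast
  have "W' = W" if "W' \<in> \<mm>" "Y' \<in> subgroup_lie_algebra G A H" "V = Y' + W'" for W' Y'
    using ex1 assms(2-4) that by (metis fst_conv snd_conv)
  then show ?thesis
    unfolding m_part_def using assms by (intro the_equality) blast+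
qed

lemma m_part_decomposition:
  assumes "V \<in> lie_algebra G A"
  obtains Y where "Y \<in> subgroup_lie_algebra G A H"
    "m_part (subgroup_lie_algebra G A H) \<mm> V \<in> \<mm>"
    "V = Y + m_part (subgroup_lie_algebra G A H) \<mm> V"
proof -
  obtain p where p: "fst p \<in> subgroup_lie_algebra G A H" "snd p \<in> \<mm>" "V = fst p + snd p"
    using direct_sum assms unfolding is_direct_sum_def by blast
  then have "m_part (subgroup_lie_algebra G A H) \<mm> V = snd p"
    using m_part_eqI[OF assms] by blast
  with p that show ?thesis by metis
qed

lemma ip_commute: "X \<in> \<mm> \<Longrightarrow> Y \<in> \<mm> \<Longrightarrow> ip X Y = ip Y X"
  using inner_product by (simp add: inner_product_on_def)

lemma ip_add_left: "X \<in> \<mm> \<Longrightarrow> Y \<in> \<mm> \<Longrightarrow> W \<in> \<mm> \<Longrightarrow> ip (X + Y) W = ip X W + ip Y W"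
  using inner_product by (simp add: inner_product_on_def)

lemma ip_scaleR_left: "X \<in> \<mm> \<Longrightarrow> W \<in> \<mm> \<Longrightarrow> ip (r *\<^sub>R X) W = r * ip X W"
  using inner_product by (simp add: inner_product_on_def)

lemma ip_uminus_left: "X \<in> \<mm> \<Longrightarrow> W \<in> \<mm> \<Longrightarrow> ip (- X) W = - ip X W"
  using ip_scaleR_left[of X W "- 1"] by simp

lemma ip_sum_left:
  assumes "finite I" "\<And>i. i \<in> I \<Longrightarrow> X i \<in> \<mm>" "W \<in> \<mm>"
  shows "ip (\<Sum>i\<in>I. r i *\<^sub>R X i) W = (\<Sum>i\<in>I. r i * ip (X i) W)"
  using assms(1,2)
proof (induction I rule: finite_induct)
  case empty
  then show ?case
    \<comment> \<open>The zero vector is written as \<open>0 *\<^sub>R W\<close>, so homogeneity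
      gives the empty sum.\<close>
    using ip_scaleR_left[OF assms(3,3), of 0] by (simp only: sum.empty scaleR_zero_left mult_zero_left)
next
  case (insert i I)
  have "(\<Sum>i\<in>I. r i *\<^sub>R X i) \<in> \<mm>"
    using insert.prems by (intro subspace_sum subspace_m subspace_scale) auto
  then show ?case
    using insert assms(3)
    by (simp only: sum.insert ip_add_left ip_scaleR_left subspace_scale[OF subspace_m] insert_iff simp_thms)
qed

end

context naturally_reductive_space
begin

text \<open>The linear structure is read off the assumption that the Lie algebra is the sum of the
  subspace \<open>\<mm>\<close> and the span of its brackets.\<close>

lemma subspace_lie_algebra: "subspace (lie_algebra G A)"
  by (subst g_eq_m_plus_mm) (rule subspace_sums[OF subspace_m subspace_span])

text \<open>The same assumption places brackets of elements of \<open>\<mm>\<close> in the Lie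
  algebra, with zero as their summand from \<open>\<mm>\<close>.\<close>

lemma lie_bracket_m:
  assumes "X \<in> \<mm>" "Y \<in> \<mm>"
  shows "lie_bracket X Y \<in> lie_algebra G A"
proof -
  have "lie_bracket X Y \<in> span {lie_bracket U W | U W. U \<in> \<mm> \<and> W \<in> \<mm>}"
    using assms by (intro span_base) blast
  moreover have "lie_bracket X Y = 0 + lie_bracket X Y" by simp
  ultimately show ?thesis
    using subspace_0[OF subspace_m] by (subst g_eq_m_plus_mm) blast
qed

lemma m_part_lie_bracket_m:
  "X \<in> \<mm> \<Longrightarrow> Y \<in> \<mm> \<Longrightarrow> m_part (subgroup_lie_algebra G A H) \<mm> (lie_bracket X Y) \<in> \<mm>"
  using m_part_decomposition[OF lie_bracket_m] by metis

text \<open>Negating both parts of the decomposition of \<open>lie_bracket Y X\<close> gives one of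
  \<open>lie_bracket X Y\<close>; that the part along \<open>H\<close> may be negated is
  \<open>subgroup_lie_algebra_uminus\<close>.\<close>

lemma torsion_antisym:
  assumes "X \<in> \<mm>" "Y \<in> \<mm>" "W \<in> \<mm>"
  shows "torsion X Y W = - torsion Y X W"
proof -
  let ?m = "m_part (subgroup_lie_algebra G A H) \<mm>"
  obtain V where V: "V \<in> subgroup_lie_algebra G A H" "lie_bracket Y X = V + ?m (lie_bracket Y X)"
    using m_part_decomposition[OF lie_bracket_m[OF assms(2,1)]] by metis
  have mV: "- V \<in> subgroup_lie_algebra G A H"
    using V(1) subgroup_lie_algebra_uminus subgroup_lie_algebra_subset subspace_neg[OF subspace_lie_algebra]
    by blast
  have eq: "lie_bracket X Y = - V + - ?m (lie_bracket Y X)"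
  proof -
    have "lie_bracket X Y = - lie_bracket Y X"
      by (simp add: lie_bracket_def fun_eq_iff)
    also have "\<dots> = - V + - ?m (lie_bracket Y X)"
      by (subst V(2)) simp
    finally show ?thesis .
  qed
  have "- ?m (lie_bracket Y X) \<in> \<mm>"
    using m_part_lie_bracket_m assms subspace_neg[OF subspace_m] by blast
  then have "?m (lie_bracket X Y) = - ?m (lie_bracket Y X)"
    by (rule m_part_eqI[OF lie_bracket_m[OF assms(1,2)] _ mV eq])
  then show ?thesis
    by (simp add: ip_uminus_left m_part_lie_bracket_m assms)
qed

text \<open>Linearity in the second slot is read off natural reductivity, which moves that argument
  out of the bracket; this avoids showing that the Lie algebra of \<open>H\<close> is closed under addition.\<close>

lemma torsion_sum_2:
  assumes "finite I" "X \<in> \<mm>" "\<And>i. i \<in> I \<Longrightarrow> Y i \<in> \<mm>" "W \<in> \<mm>"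
  shows "torsion X (\<Sum>i\<in>I. r i *\<^sub>R Y i) W = (\<Sum>i\<in>I. r i * torsion X (Y i) W)"
proof -
  have swap: "torsion X V W = - ip V (m_part (subgroup_lie_algebra G A H) \<mm> (lie_bracket X W))"
    if "V \<in> \<mm>" for V
    using naturally_reductive assms(2,4) that by (simp add: eq_neg_iff_add_eq_0)
  have "(\<Sum>i\<in>I. r i *\<^sub>R Y i) \<in> \<mm>"
    using assms by (intro subspace_sum subspace_m subspace_scale) auto
  then show ?thesis
    using assms by (simp add: swap ip_sum_left m_part_lie_bracket_m sum_negf)
qed

text \<open>Antisymmetry carries linearity from the second slot to the first.\<close>

lemma torsion_sum_1:
  assumes "finite I" "\<And>i. i \<in> I \<Longrightarrow> X i \<in> \<mm>" "Y \<in> \<mm>" "W \<in> \<mm>"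
  shows "torsion (\<Sum>i\<in>I. r i *\<^sub>R X i) Y W = (\<Sum>i\<in>I. r i * torsion (X i) Y W)"
proof -
  have "(\<Sum>i\<in>I. r i *\<^sub>R X i) \<in> \<mm>"
    using assms by (intro subspace_sum subspace_m subspace_scale) auto
  then have "torsion (\<Sum>i\<in>I. r i *\<^sub>R X i) Y W = - torsion Y (\<Sum>i\<in>I. r i *\<^sub>R X i) W"
    using assms by (intro torsion_antisym) auto
  also have "\<dots> = (\<Sum>i\<in>I. r i * - torsion Y (X i) W)"
    using assms by (simp add: torsion_sum_2 sum_negf)
  also have "\<dots> = (\<Sum>i\<in>I. r i * torsion (X i) Y W)"
    using assms torsion_antisym[of _ Y W] by (intro sum.cong) auto
  finally show ?thesis .
qed

lemma torsion_sum_3: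
  assumes "finite I" "X \<in> \<mm>" "Y \<in> \<mm>" "\<And>i. i \<in> I \<Longrightarrow> W i \<in> \<mm>"
  shows "torsion X Y (\<Sum>i\<in>I. r i *\<^sub>R W i) = (\<Sum>i\<in>I. r i * torsion X Y (W i))"
proof -
  have swap: "torsion X Y V = ip V (m_part (subgroup_lie_algebra G A H) \<mm> (lie_bracket X Y))"
    if "V \<in> \<mm>" for V
    using ip_commute m_part_lie_bracket_m assms(2,3) that by blast
  have "(\<Sum>i\<in>I. r i *\<^sub>R W i) \<in> \<mm>"
    using assms by (intro subspace_sum subspace_m subspace_scale) auto
  then have "torsion X Y (\<Sum>i\<in>I. r i *\<^sub>R W i)
      = (\<Sum>i\<in>I. r i * ip (W i) (m_part (subgroup_lie_algebra G A H) \<mm> (lie_bracket X Y)))"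
    using assms by (simp only: swap) (intro ip_sum_left m_part_lie_bracket_m; simp)
  also have "\<dots> = (\<Sum>i\<in>I. r i * torsion X Y (W i))"
    using assms(4) swap by (intro sum.cong) (simp_all only:)
  finally show ?thesis .
qed

text \<open>\<open>Ad G h\<close> preserves both summands of the reductive decomposition, so it
  commutes with taking the part in \<open>\<mm>\<close>; invariance of \<open>ip\<close>
  concludes.\<close>

lemma torsion_Ad:
  assumes h: "h \<in> H" and "X \<in> \<mm>" "Y \<in> \<mm>" "W \<in> \<mm>"
  shows "torsion (Ad G h X) (Ad G h Y) (Ad G h W) = torsion X Y W"
proof -
  let ?m = "m_part (subgroup_lie_algebra G A H) \<mm>"
  obtain V where V: "V \<in> subgroup_lie_algebra G A H" "lie_bracket X Y = V + ?m (lie_bracket X Y)"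
    using m_part_decomposition[OF lie_bracket_m[OF assms(2,3)]] by metis
  have m: "?m (lie_bracket X Y) \<in> \<mm>"
    using assms m_part_lie_bracket_m by blast
  have g: "lie_bracket (Ad G h X) (Ad G h Y) \<in> lie_algebra G A"
    using assms lie_bracket_m Ad_m by blast
  have eq: "lie_bracket (Ad G h X) (Ad G h Y) = Ad G h V + Ad G h (?m (lie_bracket X Y))"
    using V(2) Ad_lie_bracket Ad_add by metis
  \<comment> \<open>Membership of \<open>Ad G h V\<close> in the Lie algebra is obtained by
    subtraction: the other two terms of the decomposition already lie there.\<close>
  then have "Ad G h V = lie_bracket (Ad G h X) (Ad G h Y) - Ad G h (?m (lie_bracket X Y))"
    by simp
  then have "Ad G h V \<in> lie_algebra G A"
    using subspace_diff[OF subspace_lie_algebra g m_subset[OF Ad_m[OF h m]]] by simp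
  then have "Ad G h V \<in> subgroup_lie_algebra G A H"
    using subgroup_lie_algebra_Ad[OF subgroup_H h V(1)] by blast
  then have "?m (lie_bracket (Ad G h X) (Ad G h Y)) = Ad G h (?m (lie_bracket X Y))"
    by (rule m_part_eqI[OF g Ad_m[OF h m] _ eq])
  then show ?thesis
    using ip_invariant h m assms by simp
qed

end


section \<open>Clifford multiplication\<close>

context clifford_algebra
begin

lemma clifford_vec_square: "clifford_vec e v * clifford_vec e v = - ((norm v)\<^sup>2 *\<^sub>R 1)"
proof -
  have 1: "clifford_vec e v * clifford_vec e v = (\<Sum>i\<in>UNIV. \<Sum>j\<in>UNIV. (v $ i * v $ j) *\<^sub>R (e i * e j))"
    by (simp add: clifford_vec_def sum_product mult.commute)
  \<comment> \<open>Exchanging the names of the summation indices reverses the products. Adding both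
    expansions produces the anticommutators of the Clifford relations, at the cost of a factor
    2.\<close>
  then have 2: "clifford_vec e v * clifford_vec e v = (\<Sum>i\<in>UNIV. \<Sum>j\<in>UNIV. (v $ i * v $ j) *\<^sub>R (e j * e i))"
    by (subst sum.swap) (simp add: mult.commute)
  have "2 *\<^sub>R (clifford_vec e v * clifford_vec e v)
      = (\<Sum>i\<in>UNIV. \<Sum>j\<in>UNIV. (v $ i * v $ j) *\<^sub>R (e i * e j + e j * e i))"
    unfolding scaleR_2 by (subst 1, subst 2) (simp add: scaleR_add_right sum.distrib)
  also have "\<dots> = (\<Sum>i\<in>UNIV. (v $ i * v $ i) *\<^sub>R (- 2))"
    unfolding clifford_relations by (simp add: if_distrib cong: if_cong)
  also have "\<dots> = 2 *\<^sub>R (- ((norm v)\<^sup>2 *\<^sub>R 1))"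
  proof -
    have "(norm v)\<^sup>2 = (\<Sum>i\<in>UNIV. v $ i * v $ i)"
      by (simp add: power2_norm_eq_inner inner_vec_def)
    moreover have "r *\<^sub>R (2 :: 'c) = (2 * r) *\<^sub>R 1" for r
      by (metis mult.commute one_add_one scaleR_2 scaleR_scaleR)
    ultimately show ?thesis
      by (simp add: sum_negf scaleR_sum_left scaleR_sum_right)
  qed
  finally show ?thesis by (simp only: scaleR_cancel_left) simp
qed

text \<open>A unit vector squares to \<open>- 1\<close>, so its negative inverts it, and inverses
  multiply in reverse order.\<close>

lemma spin_group_right_inverse:
  assumes "s \<in> spin_group e"
  shows "\<exists>t. s * t = 1"
proof -
  obtain vs where vs: "s = prod_list (map (clifford_vec e) vs)" "\<forall>v\<in>set vs. norm v = 1"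
    using assms unfolding spin_group_def by blast
  have "\<exists>t. prod_list (map (clifford_vec e) vs) * t = 1"
    using vs(2)
  proof (induction vs)
    case (Cons v vs)
    then obtain t where "prod_list (map (clifford_vec e) vs) * t = 1" by auto
    then have "prod_list (map (clifford_vec e) (v # vs)) * (t * - clifford_vec e v)
        = - (clifford_vec e v * clifford_vec e v)"
      by (metis (no_types, lifting) list.simps(9) minus_mult_right mult.assoc mult_1 prod_list.Cons)
    also have "\<dots> = 1"
      using Cons.prems by (simp add: clifford_vec_square)
    finally show ?case by blast
  qed simp
  then show ?thesis using vs(1) by simp
qed

end

section \<open>Real linearity and change of basis in trilinear sums\<close>

lemma linear_matrix_vector_mult:
  fixes M :: "complex ^ 'd ^ 'c"
  shows "linear (\<lambda>x. M *v x)"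
  by (rule linearI) (simp_all add: vec_eq_iff matrix_vector_mult_def sum.distrib distrib_left
      scaleR_sum_right)

lemma linear_matrix_vector_mult_left:
  fixes x :: "complex ^ 'd"
  shows "linear (\<lambda>M :: complex ^ 'd ^ 'c. M *v x)"
  by (rule linearI) (simp_all add: vec_eq_iff matrix_vector_mult_def sum.distrib distrib_right
      scaleR_sum_right)

lemma sum_swap_triple:
  "(\<Sum>i\<in>UNIV. \<Sum>j\<in>UNIV. \<Sum>k\<in>UNIV. \<Sum>b\<in>B. f i j k b)
    = (\<Sum>b\<in>B. \<Sum>i\<in>(UNIV :: 'n set). \<Sum>j\<in>(UNIV :: 'n set). \<Sum>k\<in>(UNIV :: 'n set). f i j k b)"
  unfolding sum.swap[where A = "UNIV :: 'n set" and B = B] ..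

text \<open>Expanding \<open>T\<close> in every slot moves the matrix \<open>Q\<close> from the
  arguments to the coefficients, where hypothesis \<open>c\<close> absorbs it.\<close>

lemma trilinear_sum_invariant:
  fixes T :: "'a::real_vector \<Rightarrow> 'b::real_vector \<Rightarrow> 'c::real_vector \<Rightarrow> 'v::real_vector"
    and Q :: "'n::finite \<Rightarrow> 'n \<Rightarrow> real"
  assumes lin: "\<And>y z. linear (\<lambda>x. T x y z)" "\<And>x z. linear (\<lambda>y. T x y z)" "\<And>x y. linear (T x y)"
    and c: "\<And>l m n. c l m n = (\<Sum>i\<in>UNIV. \<Sum>j\<in>UNIV. \<Sum>k\<in>UNIV. Q l i * (Q m j * (Q n k * c i j k)))"
  shows "(\<Sum>i\<in>UNIV. \<Sum>j\<in>UNIV. \<Sum>k\<in>UNIV. c i j k *\<^sub>R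
        T (\<Sum>l\<in>UNIV. Q l i *\<^sub>R x l) (\<Sum>m\<in>UNIV. Q m j *\<^sub>R y m) (\<Sum>n\<in>UNIV. Q n k *\<^sub>R z n))
    = (\<Sum>l\<in>UNIV. \<Sum>m\<in>UNIV. \<Sum>n\<in>UNIV. c l m n *\<^sub>R T (x l) (y m) (z n))"
proof -
  have "c i j k *\<^sub>R T (\<Sum>l\<in>UNIV. Q l i *\<^sub>R x l) (\<Sum>m\<in>UNIV. Q m j *\<^sub>R y m) (\<Sum>n\<in>UNIV. Q n k *\<^sub>R z n)
      = (\<Sum>l\<in>UNIV. \<Sum>m\<in>UNIV. \<Sum>n\<in>UNIV. (Q l i * (Q m j * (Q n k * c i j k))) *\<^sub>R T (x l) (y m) (z n))"
    for i j k
    unfolding linear_sum[OF lin(1)] linear_scale[OF lin(1)]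
    unfolding linear_sum[OF lin(2)] linear_scale[OF lin(2)]
    unfolding linear_sum[OF lin(3)] linear_scale[OF lin(3)]
    by (simp add: scaleR_sum_right mult_ac)
  then have "(\<Sum>i\<in>UNIV. \<Sum>j\<in>UNIV. \<Sum>k\<in>UNIV. c i j k *\<^sub>R
        T (\<Sum>l\<in>UNIV. Q l i *\<^sub>R x l) (\<Sum>m\<in>UNIV. Q m j *\<^sub>R y m) (\<Sum>n\<in>UNIV. Q n k *\<^sub>R z n))
      = (\<Sum>i\<in>UNIV. \<Sum>j\<in>UNIV. \<Sum>k\<in>UNIV. \<Sum>l\<in>UNIV. \<Sum>m\<in>UNIV. \<Sum>n\<in>UNIV.
        (Q l i * (Q m j * (Q n k * c i j k))) *\<^sub>R T (x l) (y m) (z n))"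
    by (simp only:)
  also have "\<dots> = (\<Sum>l\<in>UNIV. \<Sum>m\<in>UNIV. \<Sum>n\<in>UNIV. \<Sum>i\<in>UNIV. \<Sum>j\<in>UNIV. \<Sum>k\<in>UNIV.
        (Q l i * (Q m j * (Q n k * c i j k))) *\<^sub>R T (x l) (y m) (z n))"
    \<comment> \<open>Each round pulls one of the sums over \<open>l\<close>, \<open>m\<close>,
      \<open>n\<close> in front of those over \<open>i\<close>, \<open>j\<close>,
      \<open>k\<close>.\<close>
    by ((rule trans[OF sum_swap_triple], rule sum.cong[OF refl])+) (rule refl)
  also have "\<dots> = (\<Sum>l\<in>UNIV. \<Sum>m\<in>UNIV. \<Sum>n\<in>UNIV. c l m n *\<^sub>R T (x l) (y m) (z n))"
    by (simp only: scaleR_sum_left[symmetric] c[symmetric])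
  finally show ?thesis .
qed

lemma sum_fun_apply: "(\<Sum>i\<in>I. F i) x = (\<Sum>i\<in>I. F i x)"
  by (induction I rule: infinite_finite_induct)
    (simp_all only: sum.infinite sum.empty sum.insert zero_fun_def plus_fun_def simp_thms)


section \<open>The operator on spinor fields\<close>

text \<open>Both structures are taken over the same reductive space, so that the torsion identities
  and the spin lift are available together.\<close>

locale naturally_reductive_spin_space =
  naturally_reductive_space G A H \<mm> ip +
  homogeneous_spin_structure G A H \<mm> ip e \<rho> Z lift_Ad
  for G :: "'g::{t2_space, second_countable_topology} monoid"
    and A :: "('g, 'e::euclidean_space) atlas"
    and H \<mm> ip
    and e :: "'n::{finite, linorder} \<Rightarrow> 'c::real_normed_algebra_1"
    and \<rho> :: "'c \<Rightarrow> complex ^ 'd ^ 'd"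
    and Z :: "'n \<Rightarrow> 'g vfield"
    and lift_Ad :: "'g \<Rightarrow> 'c"
begin

abbreviation spinors :: "('g \<Rightarrow> complex ^ 'd) set" where
  "spinors \<equiv> spinor_fields G A H \<rho> lift_Ad"

abbreviation \<D> :: "('g \<Rightarrow> complex ^ 'd) \<Rightarrow> 'g \<Rightarrow> complex ^ 'd" where
  "\<D> \<equiv> D_operator G A H \<mm> ip Z e \<rho>"

text \<open>The first index is the row: column \<open>i\<close> holds the coordinates of
  \<open>Ad G h (Z i)\<close>, as in \<open>Ad_SO\<close>.\<close>

definition Ad_matrix :: "'g \<Rightarrow> 'n \<Rightarrow> 'n \<Rightarrow> real" where
  "Ad_matrix h l i = ip (Ad G h (Z i)) (Z l)"

lemma Z_m: "Z i \<in> \<mm>"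
  using orthonormal_basis unfolding orthonormal_basis_of_def by blast

lemma Z_vector_field: "smooth_vector_field A (Z i)"
  using Z_m m_subset lie_algebra_smooth by blast

lemma ip_Z: "ip (Z i) (Z j) = (if i = j then 1 else 0)"
  using orthonormal_basis unfolding orthonormal_basis_of_def by blast

lemma Z_expansion:
  assumes "X \<in> \<mm>"
  shows "X = (\<Sum>i\<in>UNIV. ip X (Z i) *\<^sub>R Z i)"
proof -
  have "X \<in> span (range Z)"
    using assms orthonormal_basis unfolding orthonormal_basis_of_def by blast
  then obtain u where u: "X = (\<Sum>v\<in>range Z. u v *\<^sub>R v)"
    unfolding span_finite[OF finite_imageI[OF finite]] by blast
  \<comment> \<open>The span yields coefficients attached to vectors; injectivity allows them to be
    indexed by the basis labels instead.\<close>
  have "inj Z"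
    by (rule injI) (metis ip_Z zero_neq_one)
  then have X: "X = (\<Sum>i\<in>UNIV. u (Z i) *\<^sub>R Z i)"
    using u by (simp only: sum.reindex comp_def)
  have "ip X (Z j) = u (Z j)" for j
    unfolding X ip_sum_left[OF finite Z_m Z_m] ip_Z by (simp add: if_distrib cong: if_cong)
  then have "(\<Sum>i\<in>UNIV. ip X (Z i) *\<^sub>R Z i) = (\<Sum>i\<in>UNIV. u (Z i) *\<^sub>R Z i)"
    by (simp only:)
  with X show ?thesis by (rule trans[OF _ sym])
qed

lemma Ad_Z_expansion: "h \<in> H \<Longrightarrow> Ad G h (Z i) = (\<Sum>l\<in>UNIV. Ad_matrix h l i *\<^sub>R Z l)"
  unfolding Ad_matrix_def by (rule Z_expansion[OF Ad_m[OF _ Z_m]])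

lemma Ad_matrix_orthogonal:
  assumes "h \<in> H"
  shows "(\<Sum>i\<in>UNIV. Ad_matrix h l i * Ad_matrix h m i) = (if l = m then 1 else 0)"
proof -
  let ?Q = "\<chi> l i. Ad_matrix h l i"
  have "rotation_matrix ?Q"
    using Ad_SO assms unfolding Ad_matrix_def by blast
  then have "?Q ** transpose ?Q = mat 1"
    unfolding rotation_matrix_def orthogonal_matrix_def by blast
  then have "(?Q ** transpose ?Q) $ l $ m = mat 1 $ l $ m" by simp
  then show ?thesis
    by (simp add: matrix_matrix_mult_def transpose_def mat_def)
qed

text \<open>The rows of the matrix are orthonormal, so its transpose inverts it and expresses the
  old basis through the rotated one.\<close>

lemma Z_expansion_Ad:
  assumes "h \<in> H"
  shows "Z l = (\<Sum>i\<in>UNIV. Ad_matrix h l i *\<^sub>R Ad G h (Z i))"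
proof -
  have "(\<Sum>i\<in>UNIV. Ad_matrix h l i *\<^sub>R Ad G h (Z i))
      = (\<Sum>m\<in>UNIV. (\<Sum>i\<in>UNIV. Ad_matrix h l i * Ad_matrix h m i) *\<^sub>R Z m)"
    unfolding Ad_Z_expansion[OF assms] scaleR_sum_right scaleR_sum_left scaleR_scaleR by (rule sum.swap)
  also have "\<dots> = (\<Sum>m\<in>UNIV. (if l = m then Z m else 0))"
    unfolding Ad_matrix_orthogonal[OF assms]
    by (intro sum.cong refl) (metis scaleR_one scaleR_zero_left)
  also have "\<dots> = Z l"
    by (simp only: sum.delta'[OF finite] sum.delta[OF finite] UNIV_I if_True)
  finally show ?thesis ..
qed

text \<open>Each slot is expanded in the rotated basis, after which \<open>torsion_Ad\<close>
  removes \<open>Ad G h\<close>. The result has the form of hypothesis \<open>c\<close> in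
  \<open>trilinear_sum_invariant\<close>.\<close>

lemma torsion_Ad_matrix:
  assumes h: "h \<in> H"
  shows "torsion (Z l) (Z m) (Z n) = (\<Sum>i\<in>UNIV. \<Sum>j\<in>UNIV. \<Sum>k\<in>UNIV.
      Ad_matrix h l i * (Ad_matrix h m j * (Ad_matrix h n k * torsion (Z i) (Z j) (Z k))))"
proof -
  note mem = Ad_m[OF h Z_m] Z_m
  have "torsion (Z l) (Z m) (Z n) = (\<Sum>i\<in>UNIV. Ad_matrix h l i * torsion (Ad G h (Z i)) (Z m) (Z n))"
    by (subst Z_expansion_Ad[OF h, of l]) (rule torsion_sum_1[OF finite mem(1,2,2)])
  also have "\<dots> = (\<Sum>i\<in>UNIV. Ad_matrix h l i * (\<Sum>j\<in>UNIV. Ad_matrix h m j *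
      torsion (Ad G h (Z i)) (Ad G h (Z j)) (Z n)))"
    by (subst Z_expansion_Ad[OF h, of m]) (simp only: torsion_sum_2[OF finite mem(1,1,2)])
  also have "\<dots> = (\<Sum>i\<in>UNIV. Ad_matrix h l i * (\<Sum>j\<in>UNIV. Ad_matrix h m j *
      (\<Sum>k\<in>UNIV. Ad_matrix h n k * torsion (Ad G h (Z i)) (Ad G h (Z j)) (Ad G h (Z k)))))"
    by (subst Z_expansion_Ad[OF h, of n]) (simp only: torsion_sum_3[OF finite mem(1,1,1)])
  finally show ?thesis
    by (simp only: torsion_Ad[OF h Z_m Z_m Z_m] sum_distrib_left)
qed

section \<open>The lift to the spin group\<close>

lemma clifford_vec_m_coords: "clifford_vec e (m_coords ip Z X) = (\<Sum>l\<in>UNIV. ip X (Z l) *\<^sub>R e l)"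
  by (simp add: clifford_vec_def m_coords_def)

text \<open>The lift is only assumed multiplicative, so it sends the identity to an idempotent; a
  right inverse in the Clifford algebra forces this to be \<open>1\<close>.\<close>

lemma lift_one: "lift_Ad \<one>\<^bsub>G\<^esub> = 1"
proof -
  have one: "\<one>\<^bsub>G\<^esub> \<in> H" using subgroup_H by (rule subgroup.one_closed)
  then obtain t where t: "lift_Ad \<one>\<^bsub>G\<^esub> * t = 1"
    using lift_Spin spin_group_right_inverse by blast
  have "lift_Ad \<one>\<^bsub>G\<^esub> * lift_Ad \<one>\<^bsub>G\<^esub> = lift_Ad \<one>\<^bsub>G\<^esub>"
    using lift_hom one by (metis one_closed r_one)
  then show ?thesis using t by (metis mult.assoc mult.right_neutral)
qed

lemma lift_inv:
  assumes "h \<in> H"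
  shows "lift_Ad h * lift_Ad (inv\<^bsub>G\<^esub> h) = 1" "lift_Ad (inv\<^bsub>G\<^esub> h) * lift_Ad h = 1"
proof -
  have "inv\<^bsub>G\<^esub> h \<in> H" using subgroup_H assms by (rule subgroup.m_inv_closed)
  then show "lift_Ad h * lift_Ad (inv\<^bsub>G\<^esub> h) = 1" "lift_Ad (inv\<^bsub>G\<^esub> h) * lift_Ad h = 1"
    using lift_hom assms lift_one
    by (metis UNIV_I carrier_UNIV r_inv, metis UNIV_I carrier_UNIV assms lift_hom lift_one l_inv)
qed

text \<open>The covering condition evaluated at \<open>Z i\<close>, once
  \<open>clifford_inverse\<close> of the lift is recognised as the lift of the inverse.\<close>

lemma lift_conjugate:
  assumes h: "h \<in> H"
  shows "lift_Ad h * e i * lift_Ad (inv\<^bsub>G\<^esub> h) = (\<Sum>l\<in>UNIV. Ad_matrix h l i *\<^sub>R e l)"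
proof -
  have "clifford_inverse (lift_Ad h) = lift_Ad (inv\<^bsub>G\<^esub> h)"
    unfolding clifford_inverse_def using lift_inv[OF h]
    by (intro the_equality) (auto, metis mult.assoc mult.left_neutral mult.right_neutral)
  moreover have "(\<Sum>l\<in>UNIV. ip (Z i) (Z l) *\<^sub>R e l) = e i"
    by (simp add: ip_Z if_distrib[of "\<lambda>r. r *\<^sub>R _"] cong: if_cong)
  moreover have "spin_covering (lift_Ad h) (clifford_vec e (m_coords ip Z (Z i)))
      = clifford_vec e (m_coords ip Z (Ad G h (Z i)))"
    using lift_covers h Z_m by blast
  ultimately show ?thesis
    by (simp add: clifford_vec_m_coords spin_covering_def Ad_matrix_def)
qed

text \<open>Takes algebra elements instead of generator indices, so that linear combinations of
  generators may be inserted and \<open>trilinear_sum_invariant\<close> applies.\<close>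

definition clifford_trilinear :: "'c \<Rightarrow> 'c \<Rightarrow> complex ^ 'd \<Rightarrow> complex ^ 'd" where
  "clifford_trilinear a b u = \<rho> a *v (\<rho> b *v u)"

lemma clifford_trilinear_linear:
  "linear (\<lambda>a. clifford_trilinear a b u)" "linear (\<lambda>b. clifford_trilinear a b u)"
  "linear (clifford_trilinear a b)"
  unfolding clifford_trilinear_def
  using linear_compose[OF rho_linear linear_matrix_vector_mult_left]
    linear_compose[OF linear_compose[OF rho_linear linear_matrix_vector_mult_left] linear_matrix_vector_mult]
    linear_compose[OF linear_matrix_vector_mult linear_matrix_vector_mult]
  by (simp_all add: comp_def)

section \<open>Smoothness, equivariance, translation invariance and local form of the
  operator\<close>

lemma D_operator_eq:
  "\<D> \<psi> g = (\<Sum>i\<in>UNIV. \<Sum>j\<in>UNIV. \<Sum>k\<in>UNIV.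
     torsion (Z i) (Z j) (Z k) *\<^sub>R clifford_trilinear (e i) (e j) (vderiv (Z k) \<psi> g))"
  by (simp only: D_operator_def clifford_trilinear_def)

lemma smooth_map_D:
  assumes "smooth_map A \<psi>"
  shows "smooth_map A (\<D> \<psi>)"
proof -
  have bl: "bounded_linear (\<lambda>u. c *\<^sub>R clifford_trilinear a b u)" for c a b
    using clifford_trilinear_linear(3) linear_compose_scale_right linear_conv_bounded_linear by blast
  have "smooth_map A (\<lambda>g. \<Sum>i\<in>UNIV. \<Sum>j\<in>UNIV. \<Sum>k\<in>UNIV.
     torsion (Z i) (Z j) (Z k) *\<^sub>R clifford_trilinear (e i) (e j) (vderiv (Z k) \<psi> g))"
    by (intro smooth_map_sum)
      (rule smooth_map_bounded_linear[OF bl smooth_map_vderiv[OF Z_vector_field assms]])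
  then show ?thesis by (simp only: D_operator_eq[abs_def])
qed

text \<open>Vector fields are added and scaled as operators, that is, pointwise.\<close>

lemma vderiv_sum: "vderiv (\<Sum>n\<in>UNIV. q n *\<^sub>R X n) \<psi> g
    = (\<Sum>n\<in>(UNIV::'k::finite set). q n *\<^sub>R vderiv (X n) \<psi> g)"
proof -
  have "(\<Sum>n\<in>UNIV. q n *\<^sub>R X n) f x = (\<Sum>n\<in>UNIV. q n * X n f x)" for f x
    by (simp only: sum_fun_apply scaleR_fun_def real_scaleR_def)
  then show ?thesis
    unfolding vderiv_def scaleR_sum_right scaleR_scaleR
    by (subst sum.swap) (simp add: scaleR_sum_left)
qed

lemma D_equivariant:
  assumes \<psi>: "\<psi> \<in> spinors" and h: "h \<in> H"
  shows "\<D> \<psi> (g \<otimes>\<^bsub>G\<^esub> h) = \<rho> (lift_Ad (inv\<^bsub>G\<^esub> h)) *v \<D> \<psi> g"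
proof -
  let ?s = "lift_Ad h" and ?t = "lift_Ad (inv\<^bsub>G\<^esub> h)" and ?Q = "Ad_matrix h"
  let ?E = "\<lambda>i. \<Sum>l\<in>UNIV. ?Q l i *\<^sub>R e l"
  let ?u = "\<lambda>k. \<Sum>n\<in>UNIV. ?Q n k *\<^sub>R vderiv (Z n) \<psi> g"
  have sm: "smooth_map A \<psi>" and eqv: "\<And>y. \<psi> (y \<otimes>\<^bsub>G\<^esub> h) = \<rho> ?t *v \<psi> y"
    using \<psi> h unfolding spinor_fields_def by blast+
  have lin: "linear (\<lambda>u. \<rho> ?t *v u)" by (rule linear_matrix_vector_mult)
  have deriv: "vderiv (Z k) \<psi> (g \<otimes>\<^bsub>G\<^esub> h) = \<rho> ?t *v ?u k" for k
  proof -
    have "vderiv (Z k) \<psi> (g \<otimes>\<^bsub>G\<^esub> h) = vderiv (Ad G h (Z k)) (\<lambda>y. \<rho> ?t *v \<psi> y) g"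
      unfolding vderiv_Ad_right_mult[OF m_subset[OF Z_m] sm] eqv ..
    also have "\<dots> = \<rho> ?t *v vderiv (Ad G h (Z k)) \<psi> g"
      using lin sm lie_algebra_smooth[OF m_subset[OF Ad_m[OF h Z_m]]]
      by (intro vderiv_bounded_linear) (simp_all add: linear_conv_bounded_linear)
    also have "\<dots> = \<rho> ?t *v ?u k"
      unfolding Ad_Z_expansion[OF h] vderiv_sum ..
    finally show ?thesis .
  qed
  have commute: "clifford_trilinear (e i) (e j) (\<rho> ?t *v u) = \<rho> ?t *v clifford_trilinear (?E i) (?E j) u"
    for i j u
  proof -
    \<comment> \<open>The product \<open>?t * ?s = 1\<close> is inserted before each generator,
      which groups the factors into conjugates by \<open>?s\<close>.\<close>
    have "e i * e j * ?t = ?t * (?s * e i * ?t) * (?s * e j * ?t)"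
      using lift_inv[OF h] by (metis (no_types, lifting) mult.assoc mult.left_neutral)
    also have "\<dots> = ?t * ?E i * ?E j"
      by (simp only: lift_conjugate[OF h])
    finally show ?thesis
      unfolding clifford_trilinear_def matrix_vector_mul_assoc rho_mult[symmetric]
      by (simp only: mult.assoc)
  qed
  have "\<D> \<psi> (g \<otimes>\<^bsub>G\<^esub> h) = \<rho> ?t *v (\<Sum>i\<in>UNIV. \<Sum>j\<in>UNIV. \<Sum>k\<in>UNIV.
      torsion (Z i) (Z j) (Z k) *\<^sub>R clifford_trilinear (?E i) (?E j) (?u k))"
    unfolding D_operator_eq deriv commute unfolding linear_sum[OF lin] linear_scale[OF lin] ..
  also have "\<dots> = \<rho> ?t *v \<D> \<psi> g"
    unfolding D_operator_eq
    \<comment> \<open>The same matrix \<open>?Q\<close> acts on both Clifford slots and on the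
      derivative slot, and the torsion coefficients are invariant under it.\<close>
    by (subst trilinear_sum_invariant[where T = clifford_trilinear])
      (rule clifford_trilinear_linear torsion_Ad_matrix[OF h] refl)+
  finally show ?thesis .
qed

text \<open>The coefficients are constant on \<open>G\<close> and the fields \<open>Z k\<close> are
  left invariant.\<close>

lemma D_left_translate:
  assumes "smooth_map A \<psi>"
  shows "\<D> (left_translate G g \<psi>) = left_translate G g (\<D> \<psi>)"
  unfolding left_translate_def D_operator_eq[abs_def] vderiv_left_mult[OF m_subset[OF Z_m] assms] ..

text \<open>Left translations commute with the right multiplications by \<open>H\<close> in the
  equivariance condition.\<close>

lemma left_translate_spinors:
  assumes "\<psi> \<in> spinors"
  shows "left_translate G g \<psi> \<in> spinors"
  using assms smooth_map_left_mult[of \<psi> "inv\<^bsub>G\<^esub> g"]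
  unfolding spinor_fields_def left_translate_def by (simp add: m_assoc[symmetric])

lemma D_differential_operator: "differential_operator A 1 \<D>"
  unfolding differential_operator_def
proof (clarify)
  fix U \<phi> assume c: "(U, \<phi>) \<in> A"
  note o = chart_open(2)[OF c]
  have "\<forall>k. \<exists>a. smooth_on (\<phi> ` U) a \<and> (\<forall>(\<psi> :: 'g \<Rightarrow> complex ^ 'd) x. smooth_map A \<psi> \<longrightarrow> x \<in> U \<longrightarrow>
      vderiv (Z k) \<psi> x = frechet_derivative (\<psi> \<circ> inv_into U \<phi>) (at (\<phi> x)) (a (\<phi> x)))"
    using vector_field_chart[OF Z_vector_field c] by metis
  then obtain a where a: "\<And>k. smooth_on (\<phi> ` U) (a k)"
    and Z: "\<And>k x (\<psi> :: 'g \<Rightarrow> complex ^ 'd). smooth_map A \<psi> \<Longrightarrow> x \<in> U \<Longrightarrow>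
      vderiv (Z k) \<psi> x = frechet_derivative (\<psi> \<circ> inv_into U \<phi>) (at (\<phi> x)) (a k (\<phi> x))"
    by metis
  \<comment> \<open>The matrix coefficient of the partial derivative along the basis vector
    \<open>v\<close>, found by expanding each direction \<open>a k p\<close> in
    \<open>Basis\<close>.\<close>
  define M where "M v p = (\<Sum>i\<in>UNIV. \<Sum>j\<in>UNIV. \<Sum>k\<in>UNIV.
      (a k p \<bullet> v) *\<^sub>R (torsion (Z i) (Z j) (Z k) *\<^sub>R (\<rho> (e i) ** \<rho> (e j))))" for v p
  define b where "b vs = (case vs of [v] \<Rightarrow> M v | _ \<Rightarrow> (\<lambda>p. 0))" for vs
  have "smooth_on (\<phi> ` U) (M v)" for v
    unfolding M_def[abs_def]
    by (intro smooth_on_sum smooth_on_scaleR smooth_on_const o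
        smooth_on_bounded_linear[OF bounded_linear_inner_left] a)
  then have "smooth_on (\<phi> ` U) (b vs)" for vs
    unfolding b_def by (simp add: smooth_on_const split: list.split)
  moreover have "\<D> \<psi> x = (\<Sum>vs | set vs \<subseteq> Basis \<and> length vs \<le> 1.
      b vs (\<phi> x) *v iterated_derivative vs (\<psi> \<circ> inv_into U \<phi>) (\<phi> x))"
    if \<psi>: "smooth_map A \<psi>" and x: "x \<in> U" for \<psi> x
  proof -
    let ?d = "\<lambda>v. frechet_derivative (\<psi> \<circ> inv_into U \<phi>) (at (\<phi> x)) v"
    have lin: "linear (\<lambda>M :: complex ^ 'd ^ 'd. M *v y)" for y
      by (rule linear_matrix_vector_mult_left)
    have "{vs. set vs \<subseteq> Basis \<and> length vs \<le> 1} = insert [] ((\<lambda>v. [v]) ` (Basis :: 'e set))"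
      by (auto simp: le_Suc_eq length_Suc_conv)
    then have "(\<Sum>vs | set vs \<subseteq> Basis \<and> length vs \<le> 1.
        b vs (\<phi> x) *v iterated_derivative vs (\<psi> \<circ> inv_into U \<phi>) (\<phi> x)) = (\<Sum>v\<in>Basis. M v (\<phi> x) *v ?d v)"
      by (simp add: b_def sum.reindex inj_on_def image_iff)
    also have "\<dots> = (\<Sum>v\<in>Basis. \<Sum>i\<in>UNIV. \<Sum>j\<in>UNIV. \<Sum>k\<in>UNIV.
        torsion (Z i) (Z j) (Z k) *\<^sub>R clifford_trilinear (e i) (e j) ((a k (\<phi> x) \<bullet> v) *\<^sub>R ?d v))"
      unfolding M_def linear_sum[OF lin] linear_scale[OF lin] clifford_trilinear_def matrix_vector_mul_assoc
        linear_scale[OF linear_matrix_vector_mult]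
      by (simp add: mult.commute)
    also have "\<dots> = (\<Sum>i\<in>UNIV. \<Sum>j\<in>UNIV. \<Sum>k\<in>UNIV. \<Sum>v\<in>Basis.
        torsion (Z i) (Z j) (Z k) *\<^sub>R clifford_trilinear (e i) (e j) ((a k (\<phi> x) \<bullet> v) *\<^sub>R ?d v))"
      by (rule sum_swap_triple[symmetric])
    also have "\<dots> = \<D> \<psi> x"
      unfolding D_operator_eq Z[OF \<psi> x] scaleR_sum_right[symmetric]
        linear_sum[OF clifford_trilinear_linear(3), symmetric]
        frechet_derivative_Basis_expansion[OF smooth_map_chart_differentiable[OF \<psi> c x], symmetric] ..
    finally show ?thesis ..
  qed
  ultimately show "\<exists>a. (\<forall>vs. smooth_on (\<phi> ` U) (a vs)) \<and> (\<forall>\<psi>. smooth_map A \<psi> \<longrightarrow> (\<forall>x\<in>U. \<D> \<psi> x =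
      (\<Sum>vs | set vs \<subseteq> Basis \<and> length vs \<le> 1.
        a vs (\<phi> x) *v iterated_derivative vs (\<psi> \<circ> inv_into U \<phi>) (\<phi> x))))"
    by blast
qed

lemma D_invariant: "invariant_differential_operator G A spinors 1 \<D>"
proof -
  have "\<D> \<psi> \<in> spinors" if "\<psi> \<in> spinors" for \<psi>
    using D_equivariant[OF that] smooth_map_D that unfolding spinor_fields_def by blast
  moreover have "\<D> (left_translate G g \<psi>) = left_translate G g (\<D> \<psi>)" if "\<psi> \<in> spinors" for \<psi> g
    using D_left_translate that unfolding spinor_fields_def by blast
  ultimately show ?thesis
    unfolding invariant_differential_operator_def
    using D_differential_operator left_translate_spinors by blast
qed

end

theorem mainTheorem4:
  fixes G :: "'g::{t2_space, second_countable_topology} monoid"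
    and A :: "('g, 'e::euclidean_space) atlas"
    and H :: "'g set"
    and \<mm> :: "'g vfield set"
    and ip :: "'g vfield \<Rightarrow> 'g vfield \<Rightarrow> real"
    and e :: "'n::{finite, linorder} \<Rightarrow> 'c::real_normed_algebra_1"
    and \<rho> :: "'c \<Rightarrow> complex ^ 'd ^ 'd"
    and Z :: "'n \<Rightarrow> 'g vfield"
    and lift_Ad :: "'g \<Rightarrow> 'c"
  assumes "naturally_reductive_space G A H \<mm> ip"
    and "homogeneous_spin_structure G A H \<mm> ip e \<rho> Z lift_Ad"
  shows "invariant_differential_operator G A (spinor_fields G A H \<rho> lift_Ad) 1
           (D_operator G A H \<mm> ip Z e \<rho>)"
proof -
  interpret naturally_reductive_spin_space G A H \<mm> ip e \<rho> Z lift_Ad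
    using assms by (rule naturally_reductive_spin_space.intro)
  show ?thesis by (rule D_invariant)
qed

end
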